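(* Let $m,n$ be positive integers, $d=m+n$. Assume $\varepsilon>0$, $\ell\in\mathbb{N}$, and for every $1\le i\le\ell$ let $\mathbf{N}_i=(N_{i,1},\dots,N_{i,d})\in\mathbb{N}^d$, $\mathbf{v}_i=(v_{i,1},\dots,v_{i,d})\in\mathbb{Z}^d$, and let $\boldsymbol{\alpha}_i\in\mathbb{R}^m$ and $\boldsymbol{\beta}_i\in\mathbb{R}^n$ be weights. Assume $\kappa_1,\dots,\kappa_\ell$ are positive real numbers such that for every $2\le i\le \ell$ every entry of the vector $$\kappa_i(\boldsymbol{\alpha}_i,\boldsymbol{\beta}_i)-\kappa_{i-1}(\boldsymbol{\alpha}_{i-1},\boldsymbol{\beta}_{i-1})\in\mathbb{R}^{d}$$ is positive. Then for Lebesgue-almost every $\theta\in\mathrm{M}_{m,n}(\mathbb{R})$ there exist arbitrarily large $Q\in\mathbb{R}$ such that for every $1\le i\le \ell$ there exists $(\mathbf{p}_i,\mathbf{q}_i)\in\mathbb{Z}^m\times\mathbb{Z}^n$ with (1) $\|\theta\mathbf{q}_i+\mathbf{p}_i\|_{\boldsymbol{\alpha}_i}\le \varepsilon Q^{-\kappa_i}$ and $\|\mathbf{q}_i\|_{\boldsymbol{\beta}_i}\le\varepsilon Q^{\kappa_i}$; (2) $p_{i,j}\equiv v_{i,j}\pmod{N_{i,j}}$ for every $1\le j\le m$ and $q_{i,j}\equiv v_{i,m+j}\pmod{N_{i,m+j}}$ for every $1\le j\le n$.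
   Context: A $k$-dimensional weight is a probability vector in $\mathbb{R}^k$ with all entries positive. For a weight $\boldsymbol{\alpha}\in\mathbb{R}^k$, the associated quasi-norm is $\|\mathbf{x}\|_{\boldsymbol{\alpha}}=\max\{|x_j|^{1/\alpha_j}:1\le j\le k\}$ for $\mathbf{x}\in\mathbb{R}^k$. $\mathrm{M}_{m,n}(\mathbb{R})$ denotes real $m\times n$ matrices. Coordinates of $\mathbf{p}_i$ are $p_{i,j}$ and of $\mathbf{q}_i$ are $q_{i,j}$. *)

theory Defs
  imports "HOL-Analysis.Analysis" "HOL-Number_Theory.Cong"
begin

definition is_weight :: "('k::finite \<Rightarrow> real) \<Rightarrow> bool" where
  "is_weight a \<longleftrightarrow> (\<forall>j. a j > 0) \<and> (\<Sum>j\<in>UNIV. a j) = 1"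

definition qnorm :: "('k::finite \<Rightarrow> real) \<Rightarrow> real^'k \<Rightarrow> real" where
  "qnorm a x = Max (range (\<lambda>j. \<bar>x $ j\<bar> powr (1 / a j)))"

definition int_to_real_vec :: "int^'k \<Rightarrow> real^'k" where
  "int_to_real_vec z = (\<chi> j. real_of_int (z $ j))"

end

theory Submission
  imports Defs
begin

text \<open>Fix \<open>Q\<close> and put \<open>r\<^sub>i = (Q powr (- \<kappa>\<^sub>i \<alpha>\<^sub>i\<^sub>j))\<^sub>j\<close>, \<open>R\<^sub>i = (Q powr (\<kappa>\<^sub>i \<beta>\<^sub>i\<^sub>k))\<^sub>k\<close>. The entry of \<open>\<theta>\<close> in row \<open>j\<close> and column \<open>k\<close> matters
  for the \<open>i\<close>-th system only at the scale \<open>r\<^sub>i\<^sub>j / R\<^sub>i\<^sub>k\<close>, and by the monotonicity assumption these scales separate as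
  \<open>Q \<rightarrow> \<infinity>\<close>. Call \<open>\<theta>\<close> good at level \<open>i\<close> if the unimodular lattice of the vectors \<open>(\<theta>q + p, q)\<close>, rescaled by
  \<open>r\<^sub>i\<close> and \<open>R\<^sub>i\<close>, has no short vector. Around a point that is good at level \<open>i\<close>, a first moment estimate
  shows that half of the box of the level \<open>i\<close> scale is good at level \<open>i + 1\<close>; around each point that is good at level
  \<open>i + 1\<close>, a bounded covering radius provides a vector in the prescribed residue class, and moving a single
  column of \<open>\<theta>\<close> makes \<open>\<theta>q + p\<close> vanish. So a fixed proportion of the box consists of smaller boxes which solve
  the system \<open>i + 1\<close> and whose centres are good at level \<open>i + 1\<close>, and one iterates.

  To reach all of space one adds a level \<open>0\<close> with equal weights, whose boxes are cubes. Almost every \<open>\<theta>\<close> is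
  good at level \<open>0\<close> for arbitrarily large \<open>Q\<close>, with a constant depending on \<open>\<theta>\<close>, so the exceptional set has upper
  density less than one along small balls around each of its points, and Vitali's covering theorem shows that it is
  negligible.\<close>

section \<open>Boxes and slabs of matrices\<close>

definition gbox :: "real^'n^'m \<Rightarrow> ('m::finite \<Rightarrow> 'n::finite \<Rightarrow> real) \<Rightarrow> (real^'n^'m) set" where
  "gbox \<theta>0 s = {\<theta>. \<forall>j k. \<bar>\<theta>$j$k - \<theta>0$j$k\<bar> \<le> s j k}"

text \<open>The \<open>j\<close>-th coordinate of \<theta>q + p. Integer vectors are plain functions
  here; they become elements of \<open>int^'m\<close> and \<open>int^'n\<close> only in the final
  theorem.\<close>

definition lf :: "real^'n^'m \<Rightarrow> ('m::finite \<Rightarrow> int) \<Rightarrow> ('n::finite \<Rightarrow> int) \<Rightarrow> 'm \<Rightarrow> real" where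
  "lf \<theta> p q j = (\<Sum>k\<in>UNIV. \<theta>$j$k * of_int (q k)) + of_int (p j)"

lemma prod_Basis_matrix:
  "(\<Prod>b\<in>(Basis :: (real^'n^'m) set). f b) = (\<Prod>j\<in>UNIV. \<Prod>k\<in>UNIV. f (axis j (axis k 1)))"
proof -
  have B: "(Basis :: (real^'n^'m) set) = (\<lambda>(j,k). axis j (axis k 1)) ` (UNIV \<times> UNIV)"
    by (auto simp: Basis_vec_def)
  have "inj_on (\<lambda>(j::'m,k::'n). axis j (axis k (1::real))) (UNIV \<times> UNIV)"
    by (auto simp: inj_on_def axis_eq_axis)
  then have "(\<Prod>b\<in>(Basis :: (real^'n^'m) set). f b) = (\<Prod>(j,k)\<in>UNIV \<times> UNIV. f (axis j (axis k 1)))"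
    unfolding B by (subst prod.reindex) (auto simp: case_prod_unfold)
  then show ?thesis by (simp add: prod.cartesian_product)
qed

lemma gbox_eq_cbox:
  "gbox \<theta>0 s = cbox (\<theta>0 - (\<chi> j k. s j k)) (\<theta>0 + (\<chi> j k. s j k))"
proof -
  have "\<bar>a - b\<bar> \<le> c \<longleftrightarrow> b - c \<le> a \<and> a \<le> b + c" for a b c :: real
    by (auto simp: abs_le_iff)
  then show ?thesis
    unfolding gbox_def by (auto simp: mem_box Basis_vec_def inner_axis)
qed

lemma gbox_lmeasurable [simp, intro]: "gbox \<theta>0 s \<in> lmeasurable"
  by (simp add: gbox_eq_cbox)

lemma measure_gbox:
  assumes "\<And>j k. s j k \<ge> 0"
  shows "measure lebesgue (gbox \<theta>0 s) = (\<Prod>j\<in>UNIV. \<Prod>k\<in>UNIV. 2 * s j k)"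
proof -
  have "(\<theta>0 + (\<chi> j k. s j k)) \<bullet> axis j (axis k 1) - (\<theta>0 - (\<chi> j k. s j k)) \<bullet> axis j (axis k 1)
      = 2 * s j k" for j k
    by (simp add: inner_axis)
  moreover have "(\<theta>0 - (\<chi> j k. s j k)) \<bullet> b \<le> (\<theta>0 + (\<chi> j k. s j k)) \<bullet> b" if "b \<in> Basis" for b
    using that assms by (auto simp: Basis_vec_def inner_axis inner_simps)
  ultimately have "measure lborel (gbox \<theta>0 s) = (\<Prod>j\<in>UNIV. \<Prod>k\<in>UNIV. 2 * s j k)"
    unfolding gbox_eq_cbox by (subst content_cbox) (blast, simp only: prod_Basis_matrix)
  moreover have "measure lebesgue (gbox \<theta>0 s) = measure lborel (gbox \<theta>0 s)"
    by (simp add: gbox_eq_cbox)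
  ultimately show ?thesis by simp
qed

lemma lf_add_matrix:
  "lf (\<theta> + \<phi>) p q j = lf \<theta> p q j + (\<Sum>k\<in>UNIV. \<phi>$j$k * of_int (q k))"
  by (simp add: lf_def sum.distrib algebra_simps)

lemma lf_diff: "lf \<theta> (\<lambda>j. p j - p' j) (\<lambda>k. q k - q' k) j = lf \<theta> p q j - lf \<theta> p' q' j"
  by (simp add: lf_def sum_subtractf algebra_simps)

lemma lf_add: "lf \<theta> (\<lambda>j. p j + p' j) (\<lambda>k. q k + q' k) j = lf \<theta> p q j + lf \<theta> p' q' j"
  by (simp add: lf_def sum.distrib algebra_simps)

lemma lf_bound:
  assumes "\<theta> \<in> gbox \<theta>0 s"
  shows "\<bar>lf \<theta> p q j - lf \<theta>0 p q j\<bar> \<le> (\<Sum>k\<in>UNIV. s j k * \<bar>of_int (q k)\<bar>)"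
proof -
  have "lf \<theta> p q j - lf \<theta>0 p q j = (\<Sum>k\<in>UNIV. (\<theta>$j$k - \<theta>0$j$k) * of_int (q k))"
    by (simp add: lf_def sum_subtractf algebra_simps)
  also have "\<bar>\<dots>\<bar> \<le> (\<Sum>k\<in>UNIV. \<bar>(\<theta>$j$k - \<theta>0$j$k) * of_int (q k)\<bar>)"
    by (rule sum_abs)
  also have "\<dots> \<le> (\<Sum>k\<in>UNIV. s j k * \<bar>of_int (q k)\<bar>)"
    using assms by (intro sum_mono) (auto simp: abs_mult gbox_def intro: mult_right_mono)
  finally show ?thesis .
qed

definition slab :: "real^'n^'m \<Rightarrow> ('m::finite \<Rightarrow> 'n::finite \<Rightarrow> real) \<Rightarrow> ('m \<Rightarrow> real) \<Rightarrow> ('m \<Rightarrow> int) \<Rightarrow> ('n \<Rightarrow> int) \<Rightarrow> (real^'n^'m) set"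
  where "slab \<theta>0 s \<rho> p q = {\<theta> \<in> gbox \<theta>0 s. \<forall>j. \<bar>lf \<theta> p q j\<bar> \<le> \<rho> j}"

lemma slab_lmeasurable [simp, intro]: "slab \<theta>0 s \<rho> p q \<in> lmeasurable"
proof (rule lmeasurable_compact)
  have "closed {\<theta>::real^'a^'b. \<forall>j. \<bar>lf \<theta> p q j\<bar> \<le> \<rho> j}"
    unfolding lf_def by (intro closed_Collect_all closed_Collect_le continuous_intros)
  moreover have "slab \<theta>0 s \<rho> p q = gbox \<theta>0 s \<inter> {\<theta>. \<forall>j. \<bar>lf \<theta> p q j\<bar> \<le> \<rho> j}"
    by (auto simp: slab_def)
  ultimately show "compact (slab \<theta>0 s \<rho> p q)"
    by (simp add: gbox_eq_cbox compact_Int_closed)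
qed

text \<open>The slab has many disjoint translates, in the directions of column \<open>k\<close>, inside the box
  enlarged twice in that column; this replaces an application of Fubini's theorem.\<close>

lemma measure_slab_le:
  fixes \<theta>0 :: "real^'n^'m"
  assumes s: "\<And>j k. s j k > 0" and \<rho>: "\<And>j. \<rho> j > 0" and qk: "q k \<noteq> 0"
  shows "measure lebesgue (slab \<theta>0 s \<rho> p q)
         \<le> measure lebesgue (gbox \<theta>0 s) * (\<Prod>j\<in>UNIV. 6 * \<rho> j / (s j k * \<bar>of_int (q k)\<bar>))"
proof -
  define Q where "Q = \<bar>real_of_int (q k)\<bar>"
  have Q: "Q > 0" using qk by (simp add: Q_def)
  \<comment> \<open>A shift of length \<open>3 * \<rho> j / Q\<close> in column \<open>k\<close>
    changes the form by \<open>3 * \<rho> j\<close>, more than the width \<open>2 * \<rho> j\<close>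
    of the slab, so the translates are disjoint. Rounding up leaves at least
    \<open>s j k * Q / (3 * \<rho> j)\<close> shifts, none longer than \<open>s j k\<close>.\<close>
  define M where "M j = nat \<lceil>s j k * Q / (3 * \<rho> j)\<rceil>" for j
  define A where "A = PiE UNIV (\<lambda>j. {..<M j})"
  define w where "w a = (\<chi> j l. if l = k then 3 * \<rho> j * real (a j) / Q else 0 :: real^'n^'m)" for a
  define s2 where "s2 j l = (if l = k then 2 * s j l else s j l)" for j l
  let ?Z = "slab \<theta>0 s \<rho> p q"
  have M1: "s j k * Q / (3 * \<rho> j) \<le> real (M j)" for j
    unfolding M_def by linarith
  have M2: "real (a) \<le> s j k * Q / (3 * \<rho> j)" if "a < M j" for a j
    using that unfolding M_def by linarith
  have sub: "(+) (w a) ` ?Z \<subseteq> gbox \<theta>0 s2" if a: "a \<in> A" for a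
  proof
    fix \<theta> assume "\<theta> \<in> (+) (w a) ` ?Z"
    then obtain t where t: "t \<in> gbox \<theta>0 s" "\<theta> = w a + t" by (auto simp: slab_def)
    have "\<bar>\<theta>$j$l - \<theta>0$j$l\<bar> \<le> s2 j l" for j l
    proof (cases "l = k")
      case True
      have "a j < M j" using a by (auto simp: A_def)
      then have "3 * \<rho> j * real (a j) \<le> s j k * Q"
        using M2[of "a j" j] \<rho>[of j] by (simp add: field_simps)
      then have "0 \<le> 3 * \<rho> j * real (a j) / Q" "3 * \<rho> j * real (a j) / Q \<le> s j k"
        using Q \<rho>[of j] by (auto simp: field_simps)
      moreover have "\<bar>t$j$k - \<theta>0$j$k\<bar> \<le> s j k" using t by (auto simp: gbox_def)
      ultimately show ?thesis using True t by (simp add: s2_def w_def)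
    next
      case False
      then show ?thesis using t by (auto simp: s2_def w_def gbox_def)
    qed
    then show "\<theta> \<in> gbox \<theta>0 s2" by (simp add: gbox_def)
  qed
  have disj: "disjnt ((+) (w a) ` ?Z) ((+) (w b) ` ?Z)" if ab: "a \<in> A" "b \<in> A" "a \<noteq> b" for a b
  proof (rule ccontr)
    assume "\<not> ?thesis"
    then obtain x y where x: "x \<in> ?Z" and y: "y \<in> ?Z" and xy: "w a + x = w b + y"
      by (auto simp: disjnt_def)
    obtain j where j: "a j \<noteq> b j" using ab by auto
    have e: "(\<Sum>l\<in>UNIV. w c $ j $ l * of_int (q l)) = 3 * \<rho> j * real (c j) * (of_int (q k) / Q)" for c
    proof -
      have "(\<Sum>l\<in>UNIV. w c $ j $ l * of_int (q l)) = (\<Sum>l\<in>UNIV. if l = k then 3 * \<rho> j * real (c j) * (of_int (q k) / Q) else 0)"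
        by (intro sum.cong) (auto simp: w_def)
      then show ?thesis by simp
    qed
    have "lf (x + w a) p q j = lf (y + w b) p q j" using xy by (simp add: add.commute)
    then have "lf x p q j - lf y p q j = 3 * \<rho> j * (real (b j) - real (a j)) * (of_int (q k) / Q)"
      unfolding lf_add_matrix e by (simp add: algebra_simps)
    also have "\<bar>\<dots>\<bar> = 3 * \<rho> j * \<bar>real (b j) - real (a j)\<bar>"
      using Q \<rho>[of j] by (simp add: abs_mult Q_def)
    also have "\<dots> \<ge> 3 * \<rho> j * 1"
      using j \<rho>[of j] by (intro mult_left_mono) auto
    finally have "3 * \<rho> j \<le> \<bar>lf x p q j - lf y p q j\<bar>" by simp
    moreover have "\<bar>lf x p q j\<bar> \<le> \<rho> j" "\<bar>lf y p q j\<bar> \<le> \<rho> j" using x y by (auto simp: slab_def)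
    ultimately show False using \<rho>[of j] by linarith
  qed
  have fA: "finite A" by (simp add: A_def finite_PiE)
  have cA: "card A = (\<Prod>j\<in>UNIV. M j)" by (simp add: A_def card_PiE)
  have "real (card A) * measure lebesgue ?Z = (\<Sum>a\<in>A. measure lebesgue ((+) (w a) ` ?Z))"
    by (simp add: measure_translation)
  also have "\<dots> = measure lebesgue (\<Union>a\<in>A. (+) (w a) ` ?Z)"
    by (rule measure_UNION'[symmetric])
       (use fA disj in \<open>auto simp: pairwise_def intro: measurable_translation\<close>)
  also have "\<dots> \<le> measure lebesgue (gbox \<theta>0 s2)"
    using sub fA by (intro measure_mono_fmeasurable) (auto intro!: sets.finite_UN fmeasurableD measurable_translation)
  \<comment> \<open>One side doubles in each row, so the box grows by \<open>2 ^ CARD('m)\<close>;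
    with the 3 from the step length this gives the factor 6 per row.\<close>
  also have "\<dots> = (\<Prod>j\<in>UNIV. 2 * (\<Prod>l\<in>UNIV. 2 * s j l))"
  proof -
    have "s2 j l \<ge> 0" for j l using s[of j l] by (auto simp: s2_def)
    moreover have "(\<Prod>l\<in>UNIV. 2 * s2 j l) = 2 * (\<Prod>l\<in>UNIV. 2 * s j l)" for j
    proof -
      have "(\<Prod>l\<in>UNIV. 2 * s2 j l) = (\<Prod>l\<in>UNIV. (if l = k then 2 else 1) * (2 * s j l))"
        by (intro prod.cong) (auto simp: s2_def)
      then show ?thesis by (simp add: prod.distrib)
    qed
    ultimately show ?thesis by (simp add: measure_gbox)
  qed
  also have "\<dots> = (\<Prod>j::'m\<in>UNIV. 2) * measure lebesgue (gbox \<theta>0 s)"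
  proof -
    have "s j l \<ge> 0" for j l using s[of j l] by simp
    then show ?thesis by (simp only: measure_gbox prod.distrib)
  qed
  finally have 1: "(\<Prod>j\<in>UNIV. real (M j)) * measure lebesgue ?Z \<le> (\<Prod>j::'m\<in>UNIV. 2) * measure lebesgue (gbox \<theta>0 s)"
    by (simp add: cA)
  have "(\<Prod>j\<in>UNIV. s j k * Q / (3 * \<rho> j)) * measure lebesgue ?Z \<le> (\<Prod>j\<in>UNIV. real (M j)) * measure lebesgue ?Z"
    using s \<rho> Q M1 by (intro mult_right_mono prod_mono) (auto simp: less_imp_le)
  with 1 have 2: "(\<Prod>j\<in>UNIV. s j k * Q / (3 * \<rho> j)) * measure lebesgue ?Z \<le> (\<Prod>j::'m\<in>UNIV. 2) * measure lebesgue (gbox \<theta>0 s)"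
    by linarith
  have pos: "(\<Prod>j\<in>UNIV. s j k * Q / (3 * \<rho> j)) > 0"
    using s \<rho> Q by (intro prod_pos) auto
  have "measure lebesgue ?Z \<le> (\<Prod>j::'m\<in>UNIV. 2) * measure lebesgue (gbox \<theta>0 s) / (\<Prod>j\<in>UNIV. s j k * Q / (3 * \<rho> j))"
    using 2 pos by (simp add: pos_le_divide_eq mult.commute)
  also have "\<dots> = measure lebesgue (gbox \<theta>0 s) * (\<Prod>j\<in>UNIV. 2 / (s j k * Q / (3 * \<rho> j)))"
    by (simp only: prod_dividef) simp
  also have "(\<Prod>j\<in>UNIV. 2 / (s j k * Q / (3 * \<rho> j))) = (\<Prod>j\<in>UNIV. 6 * \<rho> j / (s j k * Q))"
    by (intro prod.cong) (auto simp: field_simps)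
  finally show ?thesis by (simp add: Q_def)
qed

text \<open>Pigeonhole: cut the box into half-open cells of side \<open>\<eta>\<close>. Two points
  of one cell differ by less than \<open>\<eta>\<close> in every coordinate, so each cell receives
  at most one element of \<open>S\<close>. The summand 1 pays for rounding.\<close>

lemma card_separated_le:
  fixes f :: "'a \<Rightarrow> 'i::finite \<Rightarrow> real"
  assumes \<eta>: "\<eta> > 0"
    and range: "\<And>x i. x \<in> S \<Longrightarrow> a i \<le> f x i \<and> f x i \<le> a i + len i"
    and sep: "\<And>x y. x \<in> S \<Longrightarrow> y \<in> S \<Longrightarrow> \<forall>i. \<bar>f x i - f y i\<bar> < \<eta> \<Longrightarrow> x = y"
    and len: "\<And>i. len i \<ge> 0"
  shows "finite S" and "real (card S) \<le> (\<Prod>i\<in>UNIV. len i / \<eta> + 1)"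
proof -
  define c where "c x = (\<lambda>i. nat \<lfloor>(f x i - a i) / \<eta>\<rfloor>)" for x
  define A where "A = PiE (UNIV :: 'i set) (\<lambda>i. {..nat \<lfloor>len i / \<eta>\<rfloor>})"
  have inj: "inj_on c S"
  proof (rule inj_onI)
    fix x y assume xy: "x \<in> S" "y \<in> S" "c x = c y"
    show "x = y"
    proof (rule sep[OF xy(1,2)], rule allI)
      fix i
      have nn: "0 \<le> (f x i - a i) / \<eta>" "0 \<le> (f y i - a i) / \<eta>"
        using range xy \<eta> by auto
      have "nat \<lfloor>(f x i - a i) / \<eta>\<rfloor> = nat \<lfloor>(f y i - a i) / \<eta>\<rfloor>"
        using xy(3) unfolding c_def by meson
      then have "\<lfloor>(f x i - a i) / \<eta>\<rfloor> = \<lfloor>(f y i - a i) / \<eta>\<rfloor>"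
        using nn by (metis eq_nat_nat_iff zero_le_floor)
      then have "\<bar>(f x i - a i) / \<eta> - (f y i - a i) / \<eta>\<bar> < 1" by linarith
      also have "(f x i - a i) / \<eta> - (f y i - a i) / \<eta> = (f x i - f y i) / \<eta>"
        by (simp add: diff_divide_distrib)
      finally show "\<bar>f x i - f y i\<bar> < \<eta>" using \<eta> by (simp add: abs_divide field_simps)
    qed
  qed
  have sub: "c ` S \<subseteq> A"
  proof (clarify)
    fix x assume "x \<in> S"
    then have "(f x i - a i) / \<eta> \<le> len i / \<eta>" for i
      using range[of x i] \<eta> by (intro divide_right_mono) auto
    then show "c x \<in> A" by (auto simp: A_def c_def intro!: nat_mono floor_mono)
  qed
  have fA: "finite A" by (simp add: A_def finite_PiE)
  show "finite S" using finite_imageD[OF finite_subset[OF sub fA] inj] .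
  have "real (card S) \<le> real (card A)"
    using card_inj_on_le[OF inj sub fA] by simp
  also have "\<dots> = (\<Prod>i\<in>UNIV. real (nat \<lfloor>len i / \<eta>\<rfloor>) + 1)"
    by (simp add: A_def card_PiE add.commute)
  also have "\<dots> \<le> (\<Prod>i\<in>UNIV. len i / \<eta> + 1)"
    using len \<eta> by (intro prod_mono) (auto simp: of_nat_nat)
  finally show "real (card S) \<le> (\<Prod>i\<in>UNIV. len i / \<eta> + 1)" .
qed

section \<open>Matrices whose lattice has no short vectors\<close>

text \<open>No nonzero vector of the rescaled lattice has sup norm at most \<open>\<delta>\<close>.
  Scaling the bounds instead of the vectors avoids a separate type of lattices.\<close>

definition good :: "real \<Rightarrow> ('m::finite \<Rightarrow> real) \<Rightarrow> ('n::finite \<Rightarrow> real) \<Rightarrow> real^'n^'m \<Rightarrow> bool" where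
  "good \<delta> r R \<theta> \<longleftrightarrow> (\<forall>p q. (\<forall>j. \<bar>lf \<theta> p q j\<bar> \<le> \<delta> * r j) \<longrightarrow> (\<forall>k. \<bar>real_of_int (q k)\<bar> \<le> \<delta> * R k)
     \<longrightarrow> p = (\<lambda>_. 0) \<and> q = (\<lambda>_. 0))"

text \<open>The scale at which \<theta> may move: as long as
  \<open>\<bar>q k\<bar> \<le> R k\<close>, a point of this box differs from the centre by at most
  \<open>CARD('n) * \<sigma> * r j\<close> in the \<open>j\<close>-th form.\<close>

abbreviation mbox :: "real^'n^'m \<Rightarrow> real \<Rightarrow> ('m::finite \<Rightarrow> real) \<Rightarrow> ('n::finite \<Rightarrow> real) \<Rightarrow> (real^'n^'m) set" where
  "mbox \<theta>0 \<sigma> r R \<equiv> gbox \<theta>0 (\<lambda>j k. \<sigma> * r j / R k)"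

lemma prod_UNIV_sum:
  "(\<Prod>i\<in>(UNIV::('a::finite + 'b::finite) set). h i) = (\<Prod>j\<in>UNIV. h (Inl j)) * (\<Prod>k\<in>UNIV. h (Inr k))"
proof -
  have "(\<Prod>i\<in>(UNIV::('a + 'b) set). h i) = prod h (range Inl) * prod h (range Inr)"
    by (subst UNIV_sum, rule prod.union_disjoint) auto
  then show ?thesis by (simp add: prod.reindex)
qed

text \<open>Goodness applied to the difference of two lattice vectors: this is the separation that
  \<open>card_separated_le\<close> asks for.\<close>

lemma goodD:
  assumes "good \<delta> r R \<theta>"
    "\<And>j. \<bar>lf \<theta> p q j - lf \<theta> p' q' j\<bar> \<le> \<delta> * r j" "\<And>k. \<bar>real_of_int (q k) - real_of_int (q' k)\<bar> \<le> \<delta> * R k"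
  shows "p = p'" "q = q'"
proof -
  have "(\<lambda>j. p j - p' j) = (\<lambda>_. 0) \<and> (\<lambda>k. q k - q' k) = (\<lambda>_. 0)"
    using assms(1)[unfolded good_def, rule_format, of "\<lambda>j. p j - p' j" "\<lambda>k. q k - q' k"] assms(2,3)
    by (simp add: lf_diff)
  then show "p = p'" "q = q'" by (auto simp: fun_eq_iff)
qed

text \<open>If \<open>(p, q)\<close> is short at the new scale, then \<open>\<bar>q k\<bar> / R k > \<delta>\<close> for the \<open>k\<close> that maximises this ratio. For fixed
  \<open>k\<close> these vectors are grouped by \<open>b = \<lfloor>q k / (\<delta> * R k)\<rfloor>\<close>: since \<open>\<theta>0\<close> is good at the old scale, the size of a group is
  at most a multiple of \<open>(\<bar>b\<bar> + 1) ^ CARD('m)\<close>, and this growth cancels against the measures of the slabs.\<close>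

lemma measure_not_good_le:
  fixes \<theta>0 :: "real^'n^'m" and r r' :: "'m::finite \<Rightarrow> real" and R R' :: "'n::finite \<Rightarrow> real"
  assumes r: "\<And>j. r j > 0" and R: "\<And>k. R k > 0" and r': "\<And>j. r' j > 0" and R': "\<And>k. R' k > 0"
    and vol: "(\<Prod>j\<in>UNIV. r j) * (\<Prod>k\<in>UNIV. R k) = 1" and vol': "(\<Prod>j\<in>UNIV. r' j) * (\<Prod>k\<in>UNIV. R' k) = 1"
    and \<sigma>: "\<sigma> > 0" "real CARD('n) * \<sigma> \<le> 1/2" and \<delta>: "\<delta> > 0" and \<eta>: "\<eta> > 0"
    and gd: "good \<delta> r R \<theta>0"
    and rr: "\<And>j. \<eta> * r' j \<le> \<delta> / 2 * r j" and RR: "\<And>k. \<delta> * R k \<le> \<eta> * R' k"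
  obtains W where "W \<in> lmeasurable" "{\<theta> \<in> mbox \<theta>0 \<sigma> r R. \<not> good \<eta> r' R' \<theta>} \<subseteq> W"
    "measure lebesgue W \<le> 3 * real CARD('n) * (54 * \<eta> / (\<sigma> * \<delta>)) ^ CARD('m) * (3 * \<eta> / \<delta>) ^ CARD('n)
        * measure lebesgue (mbox \<theta>0 \<sigma> r R)"
proof -
  let ?P = "mbox \<theta>0 \<sigma> r R" and ?\<mu> = "measure lebesgue"
  define s where "s = (\<lambda>j k. \<sigma> * r j / R k)"
  define V where "V k b = {(p,q). (\<forall>l. \<bar>real_of_int (q l)\<bar> \<le> \<eta> * R' l) \<and>
     (\<forall>j. \<bar>lf \<theta>0 p q j\<bar> \<le> \<bar>real_of_int (q k)\<bar> / R k * r j) \<and>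
     \<bar>real_of_int (q k)\<bar> / R k > \<delta> \<and> \<lfloor>real_of_int (q k) / (\<delta> * R k)\<rfloor> = b}" for k b
  define Z where "Z = (\<lambda>(p,q). slab \<theta>0 s (\<lambda>j. \<eta> * r' j) p q)"
  define Y where "Y k = \<eta> * R' k / (\<delta> * R k)" for k
  \<comment> \<open>The floor of a number \<open>t\<close> with
    \<open>\<bar>t\<bar> \<le> Y k\<close> can be as small as
    \<open>- \<lfloor>Y k\<rfloor> - 1\<close>, hence the additional index at the lower end.\<close>
  define I where "I k = {-\<lfloor>Y k\<rfloor> - 1 .. \<lfloor>Y k\<rfloor>}" for k
  define W where "W = (\<Union>k\<in>UNIV. \<Union>b\<in>I k. \<Union>x\<in>V k b. Z x)"
  have spos: "s j k > 0" for j k using \<sigma> r R by (simp add: s_def)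
  have Y1: "Y k \<ge> 1" for k using RR[of k] \<delta> R[of k] by (simp add: Y_def)
  have Y0: "Y k \<ge> 0" for k using Y1[of k] by linarith
  \<comment> \<open>The ratio \<open>t\<close> exceeds 1 in absolute value, so it is comparable to
    \<open>\<bar>b\<bar> + 1\<close> up to a factor 3.\<close>
  have Bnd: "\<delta> * (\<bar>of_int b\<bar> + 1) / 3 \<le> \<bar>real_of_int (q k)\<bar> / R k \<and> \<bar>real_of_int (q k)\<bar> / R k \<le> \<delta> * (\<bar>of_int b\<bar> + 1)
       \<and> \<delta> * of_int b \<le> of_int (q k) / R k \<and> of_int (q k) / R k \<le> \<delta> * of_int b + \<delta> \<and> q k \<noteq> 0"
    if "(p,q) \<in> V k b" for p q k b
  proof -
    define t where "t = real_of_int (q k) / (\<delta> * R k)"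
    have e: "real_of_int (q k) / R k = \<delta> * t" using \<delta> by (simp add: t_def)
    have e2: "\<bar>real_of_int (q k)\<bar> / R k = \<delta> * \<bar>t\<bar>" using \<delta> R[of k] by (simp add: t_def abs_mult)
    have "\<delta> * \<bar>t\<bar> > \<delta>" using that e2 by (auto simp: V_def)
    then have t1: "\<bar>t\<bar> > 1" using \<delta> by simp
    have b: "\<lfloor>t\<rfloor> = b" using that by (auto simp: V_def t_def)
    have b1: "of_int b \<le> t" "t \<le> of_int b + 1" using b by linarith+
    have "\<bar>real_of_int b\<bar> + 1 \<le> 3 * \<bar>t\<bar>" "\<bar>t\<bar> \<le> \<bar>real_of_int b\<bar> + 1" using b t1 by linarith+
    then have "\<delta> * (\<bar>real_of_int b\<bar> + 1) \<le> \<delta> * (3 * \<bar>t\<bar>)" "\<delta> * \<bar>t\<bar> \<le> \<delta> * (\<bar>real_of_int b\<bar> + 1)"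
      using \<delta> by (intro mult_left_mono; simp)+
    moreover have "\<delta> * of_int b \<le> \<delta> * t" "\<delta> * t \<le> \<delta> * (of_int b + 1)"
      using b1 \<delta> by (intro mult_left_mono; simp)+
    moreover have "q k \<noteq> 0" using t1 by (auto simp: t_def)
    ultimately show ?thesis unfolding e e2 by (simp add: algebra_simps)
  qed
  have count: "finite (V k b)" 
       "real (card (V k b)) \<le> (3 * (\<bar>of_int b\<bar> + 1)) ^ CARD('m) * (2 * (\<Prod>l\<in>UNIV - {k}. 3 * Y l))" for k b
  proof -
    \<comment> \<open>In these coordinates goodness of \<open>\<theta>0\<close> separates the points
      by \<open>\<delta>\<close>. The forms range over length
      \<open>2 * \<delta> * (\<bar>b\<bar> + 1)\<close>, the coordinate \<open>k\<close> only over
      \<open>\<delta>\<close> because \<open>b\<close> is fixed, the other ones over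
      \<open>2 * \<delta> * Y l\<close>; \<open>Y l \<ge> 1\<close> absorbs the rounding.\<close>
    define f where "f = (\<lambda>(p::'m \<Rightarrow> int,q::'n \<Rightarrow> int). case_sum (\<lambda>j. lf \<theta>0 p q j / r j) (\<lambda>l. real_of_int (q l) / R l))"
    define a where "a = case_sum (\<lambda>j::'m. - \<delta> * (\<bar>of_int b\<bar> + 1)) (\<lambda>l. if l = k then \<delta> * of_int b else - \<delta> * Y l)"
    define len where "len = case_sum (\<lambda>j::'m. 2 * \<delta> * (\<bar>of_int b\<bar> + 1)) (\<lambda>l. if l = k then \<delta> else 2 * \<delta> * Y l)"
    have rng: "a i \<le> f x i \<and> f x i \<le> a i + len i" if x: "x \<in> V k b" for x i
    proof -
      obtain p q where pq: "x = (p,q)" by (cases x)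
      note B = Bnd[OF x[unfolded pq]]
      show ?thesis
      proof (cases i)
        case (Inl j)
        have "\<bar>lf \<theta>0 p q j\<bar> \<le> \<bar>real_of_int (q k)\<bar> / R k * r j" using x by (auto simp: V_def pq)
        then have "\<bar>lf \<theta>0 p q j / r j\<bar> \<le> \<bar>real_of_int (q k)\<bar> / R k"
          using r[of j] by (simp add: abs_divide pos_divide_le_eq)
        also have "\<dots> \<le> \<delta> * (\<bar>of_int b\<bar> + 1)" using B by blast
        finally have "- (\<delta> * (\<bar>of_int b\<bar> + 1)) \<le> lf \<theta>0 p q j / r j \<and> lf \<theta>0 p q j / r j \<le> \<delta> * (\<bar>of_int b\<bar> + 1)"
          by linarith
        then show ?thesis by (simp add: Inl pq f_def a_def len_def)
      next
        case (Inr l)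
        show ?thesis
        proof (cases "l = k")
          case True
          then show ?thesis using B by (simp add: Inr pq f_def a_def len_def)
        next
          case False
          have "\<bar>real_of_int (q l)\<bar> \<le> \<eta> * R' l" using x by (auto simp: V_def pq)
          then have "\<bar>real_of_int (q l) / R l\<bar> \<le> \<delta> * Y l"
            using R[of l] \<delta> by (simp add: abs_divide pos_divide_le_eq Y_def)
          then have "- (\<delta> * Y l) \<le> real_of_int (q l) / R l \<and> real_of_int (q l) / R l \<le> \<delta> * Y l"
            by linarith
          then show ?thesis using False by (simp add: Inr pq f_def a_def len_def)
        qed
      qed
    qed
    have sep: "x = y" if "x \<in> V k b" "y \<in> V k b" "\<forall>i. \<bar>f x i - f y i\<bar> < \<delta>" for x y
    proof -
      obtain p q p' q' where pq: "x = (p,q)" "y = (p',q')" by (cases x, cases y)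
      have scale: "\<bar>x - y\<bar> \<le> \<delta> * c" if "\<bar>x / c - y / c\<bar> < \<delta>" "c > 0" for x y c :: real
      proof -
        have "\<bar>x - y\<bar> / c < \<delta>" using that by (simp flip: diff_divide_distrib)
        then show ?thesis using that by (simp add: pos_divide_less_eq)
      qed
      have "\<bar>lf \<theta>0 p q j - lf \<theta>0 p' q' j\<bar> \<le> \<delta> * r j" for j
        using scale that(3)[rule_format, of "Inl j"] r[of j] by (simp add: pq f_def)
      moreover have "\<bar>real_of_int (q l) - real_of_int (q' l)\<bar> \<le> \<delta> * R l" for l
        using scale that(3)[rule_format, of "Inr l"] R[of l] by (simp add: pq f_def)
      ultimately have "p = p'" "q = q'" using goodD[OF gd] by metis+
      then show ?thesis using pq by simp
    qed
    have len: "len i \<ge> 0" for i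
    proof (cases i)
      case (Inr l)
      have "0 \<le> 2 * \<delta> * Y l" using \<delta> Y1[of l] by (intro mult_nonneg_nonneg) auto
      then show ?thesis using \<delta> Inr by (simp add: len_def)
    next
      case (Inl j)
      then show ?thesis using \<delta> by (simp add: len_def)
    qed
    show "finite (V k b)"
      by (rule card_separated_le(1)[of \<delta> "V k b" a f len]) (fact \<delta>, erule rng, erule (2) sep, rule len)
    have "real (card (V k b)) \<le> (\<Prod>i\<in>UNIV. len i / \<delta> + 1)"
      by (rule card_separated_le(2)[of \<delta> "V k b" a f len]) (fact \<delta>, erule rng, erule (2) sep, rule len)
    also have "\<dots> \<le> (\<Prod>j::'m\<in>UNIV. 3 * (\<bar>of_int b\<bar> + 1)) * (\<Prod>l\<in>UNIV. if l = k then 2 else 3 * Y l)"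
      unfolding prod_UNIV_sum
    proof (intro mult_mono prod_mono prod_nonneg)
      fix j :: 'm
      show "0 \<le> len (Inl j) / \<delta> + 1 \<and> len (Inl j) / \<delta> + 1 \<le> 3 * (\<bar>real_of_int b\<bar> + 1)"
        using \<delta> by (simp add: len_def field_simps)
    next
      fix l
      show "0 \<le> len (Inr l) / \<delta> + 1 \<and> len (Inr l) / \<delta> + 1 \<le> (if l = k then 2 else 3 * Y l)"
        using \<delta> Y1[of l] by (simp add: len_def)
      show "0 \<le> len (Inr l) / \<delta> + 1" using len[of "Inr l"] \<delta> by simp
    qed auto
    also have "(\<Prod>l\<in>UNIV. if l = k then 2 else 3 * Y l) = 2 * (\<Prod>l\<in>UNIV - {k}. 3 * Y l)"
      by (subst prod.remove[of _ k]) auto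
    finally show "real (card (V k b)) \<le> (3 * (\<bar>of_int b\<bar> + 1)) ^ CARD('m) * (2 * (\<Prod>l\<in>UNIV - {k}. 3 * Y l))"
      by simp
  qed
  have Zm: "Z x \<in> lmeasurable" for x by (cases x) (simp add: Z_def)
  have Zle: "?\<mu> (Z x) \<le> ?\<mu> ?P * (\<Prod>j\<in>UNIV. 18 * \<eta> * r' j / (\<sigma> * \<delta> * r j) / (\<bar>of_int b\<bar> + 1))" if x: "x \<in> V k b" for x k b
  proof -
    obtain p q where pq: "x = (p,q)" by (cases x)
    note B = Bnd[OF x[unfolded pq]]
    have "?\<mu> (Z x) \<le> ?\<mu> (gbox \<theta>0 s) * (\<Prod>j\<in>UNIV. 6 * (\<eta> * r' j) / (s j k * \<bar>of_int (q k)\<bar>))"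
      unfolding Z_def pq prod.case using B \<eta> r' by (intro measure_slab_le spos) auto
    also have "gbox \<theta>0 s = ?P" by (simp add: s_def)
    also have "?\<mu> ?P * (\<Prod>j\<in>UNIV. 6 * (\<eta> * r' j) / (s j k * \<bar>of_int (q k)\<bar>))
       \<le> ?\<mu> ?P * (\<Prod>j\<in>UNIV. 18 * \<eta> * r' j / (\<sigma> * \<delta> * r j) / (\<bar>of_int b\<bar> + 1))"
    proof (intro mult_left_mono prod_mono)
      fix j :: 'm
      have q0: "\<bar>real_of_int (q k)\<bar> > 0" using B by simp
      have "s j k * \<bar>of_int (q k)\<bar> = \<sigma> * r j * (\<bar>of_int (q k)\<bar> / R k)" by (simp add: s_def)
      also have "\<dots> \<ge> \<sigma> * r j * (\<delta> * (\<bar>of_int b\<bar> + 1) / 3)"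
        using B \<sigma> r[of j] by (intro mult_left_mono) auto
      finally have "6 * (\<eta> * r' j) / (s j k * \<bar>of_int (q k)\<bar>) \<le> 6 * (\<eta> * r' j) / (\<sigma> * r j * (\<delta> * (\<bar>of_int b\<bar> + 1) / 3))"
        using \<eta> r'[of j] \<sigma> r[of j] \<delta> by (intro divide_left_mono) (auto intro!: mult_pos_pos spos q0 add_nonneg_pos)
      also have "\<dots> = 18 * \<eta> * r' j / (\<sigma> * \<delta> * r j) / (\<bar>of_int b\<bar> + 1)" by (simp add: field_simps)
      finally show "0 \<le> 6 * (\<eta> * r' j) / (s j k * \<bar>of_int (q k)\<bar>) \<and>
          6 * (\<eta> * r' j) / (s j k * \<bar>of_int (q k)\<bar>) \<le> 18 * \<eta> * r' j / (\<sigma> * \<delta> * r j) / (\<bar>of_int b\<bar> + 1)"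
        using \<eta> r'[of j] spos[of j k] by auto
    qed simp
    finally show ?thesis .
  qed
  \<comment> \<open>The factor \<open>(3 * (\<bar>b\<bar> + 1)) ^ CARD('m)\<close> of the count
    cancels the denominators in \<open>Zle\<close> and leaves \<open>54 = 3 * 18\<close>, so
    \<open>D\<close> does not depend on \<open>b\<close>.\<close>
  define D where "D = (\<Prod>j\<in>UNIV. 54 * \<eta> * r' j / (\<sigma> * \<delta> * r j))"
  have D: "D \<ge> 0" unfolding D_def using \<eta> \<sigma> \<delta> r r' by (intro prod_nonneg) (auto simp: less_imp_le)
  have Vm: "(\<Union>x\<in>V k b. Z x) \<in> lmeasurable" for k b
    using count(1) Zm by (intro fmeasurable.finite_UN) auto
  have Vle: "?\<mu> (\<Union>x\<in>V k b. Z x) \<le> ?\<mu> ?P * D * (2 * (\<Prod>l\<in>UNIV - {k}. 3 * Y l))" for k b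
  proof -
    have "?\<mu> (\<Union>x\<in>V k b. Z x) \<le> (\<Sum>x\<in>V k b. ?\<mu> (Z x))"
      using count(1) Zm by (intro measure_UNION_le) (auto simp: fmeasurableD)
    also have "\<dots> \<le> real (card (V k b)) * (?\<mu> ?P * (\<Prod>j\<in>UNIV. 18 * \<eta> * r' j / (\<sigma> * \<delta> * r j) / (\<bar>of_int b\<bar> + 1)))"
      using Zle by (intro sum_bounded_above) auto
    also have "\<dots> \<le> ((3 * (\<bar>of_int b\<bar> + 1)) ^ CARD('m) * (2 * (\<Prod>l\<in>UNIV - {k}. 3 * Y l)))
       * (?\<mu> ?P * (\<Prod>j\<in>UNIV. 18 * \<eta> * r' j / (\<sigma> * \<delta> * r j) / (\<bar>of_int b\<bar> + 1)))"
      using count(2) \<eta> \<sigma> \<delta> r r' by (intro mult_right_mono mult_nonneg_nonneg prod_nonneg) (auto simp: less_imp_le)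
    also have "\<dots> = ?\<mu> ?P * ((3 * (\<bar>of_int b\<bar> + 1)) ^ CARD('m) * (\<Prod>j\<in>UNIV. 18 * \<eta> * r' j / (\<sigma> * \<delta> * r j) / (\<bar>of_int b\<bar> + 1)))
         * (2 * (\<Prod>l\<in>UNIV - {k}. 3 * Y l))" by (simp only: mult_ac)
    also have "(3 * (\<bar>of_int b\<bar> + 1)) ^ CARD('m) * (\<Prod>j\<in>UNIV. 18 * \<eta> * r' j / (\<sigma> * \<delta> * r j) / (\<bar>of_int b\<bar> + 1))
        = (\<Prod>j\<in>(UNIV::'m set). (3 * (\<bar>of_int b\<bar> + 1)) * (18 * \<eta> * r' j / (\<sigma> * \<delta> * r j) / (\<bar>of_int b\<bar> + 1)))"
      by (subst prod.distrib) simp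
    also have "\<dots> = D" unfolding D_def
    proof (rule prod.cong[OF refl])
      fix j :: 'm
      have "\<bar>real_of_int b\<bar> + 1 \<noteq> 0" by linarith
      moreover have "(3 * c) * (18 * \<eta> * u / v / c) = 54 * \<eta> * u / v" if "c \<noteq> 0" for c u v :: real
        using that by simp
      ultimately show "(3 * (\<bar>of_int b\<bar> + 1)) * (18 * \<eta> * r' j / (\<sigma> * \<delta> * r j) / (\<bar>of_int b\<bar> + 1)) = 54 * \<eta> * r' j / (\<sigma> * \<delta> * r j)"
        by blast
    qed
    finally show ?thesis .
  qed
  have Im: "(\<Union>b\<in>I k. \<Union>x\<in>V k b. Z x) \<in> lmeasurable" for k
    by (rule fmeasurable.finite_UN) (simp add: I_def, rule Vm)
  have Ile: "?\<mu> (\<Union>b\<in>I k. \<Union>x\<in>V k b. Z x) \<le> ?\<mu> ?P * D * (3 * (\<Prod>l\<in>UNIV. 3 * Y l))" for k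
  proof -
    have "?\<mu> (\<Union>b\<in>I k. \<Union>x\<in>V k b. Z x) \<le> (\<Sum>b\<in>I k. ?\<mu> (\<Union>x\<in>V k b. Z x))"
      by (rule measure_UNION_le) (simp add: I_def, rule fmeasurableD, rule Vm)
    also have "\<dots> \<le> real (card (I k)) * (?\<mu> ?P * D * (2 * (\<Prod>l\<in>UNIV - {k}. 3 * Y l)))"
      using Vle by (intro sum_bounded_above) auto
    \<comment> \<open>\<open>I k\<close> has \<open>2 * \<lfloor>Y k\<rfloor> + 2\<close> elements,
      at most \<open>4 * Y k\<close> because \<open>Y k \<ge> 1\<close>. The sum over
      \<open>b\<close> thus supplies the factor of index \<open>k\<close> that the product
      lacks.\<close>
    also have "\<dots> \<le> (4 * Y k) * (?\<mu> ?P * D * (2 * (\<Prod>l\<in>UNIV - {k}. 3 * Y l)))"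
    proof (rule mult_right_mono)
      show "real (card (I k)) \<le> 4 * Y k" unfolding I_def using Y1[of k] by simp linarith
      show "0 \<le> ?\<mu> ?P * D * (2 * (\<Prod>l\<in>UNIV - {k}. 3 * Y l))"
        using D Y0 by (intro mult_nonneg_nonneg prod_nonneg) auto
    qed
    also have "\<dots> = ?\<mu> ?P * D * (8 / 3 * (3 * Y k * (\<Prod>l\<in>UNIV - {k}. 3 * Y l)))" by simp
    also have "3 * Y k * (\<Prod>l\<in>UNIV - {k}. 3 * Y l) = (\<Prod>l\<in>UNIV. 3 * Y l)"
      by (subst (2) prod.remove[of _ k]) auto
    also have "?\<mu> ?P * D * (8 / 3 * (\<Prod>l\<in>UNIV. 3 * Y l)) \<le> ?\<mu> ?P * D * (3 * (\<Prod>l\<in>UNIV. 3 * Y l))"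
      using D Y0 by (intro mult_left_mono mult_right_mono prod_nonneg mult_nonneg_nonneg) auto
    finally show ?thesis .
  qed
  have Wm: "W \<in> lmeasurable" unfolding W_def by (rule fmeasurable.finite_UN) (simp, rule Im)
  have prods: "D * (\<Prod>l\<in>UNIV. 3 * Y l) = (54 * \<eta> / (\<sigma> * \<delta>)) ^ CARD('m) * (3 * \<eta> / \<delta>) ^ CARD('n)"
  proof -
    have 1: "D = (54 * \<eta> / (\<sigma> * \<delta>)) ^ CARD('m) * ((\<Prod>j\<in>UNIV. r' j) / (\<Prod>j\<in>UNIV. r j))"
    proof -
      have "D = (\<Prod>j\<in>UNIV. (54 * \<eta> / (\<sigma> * \<delta>)) * (r' j / r j))"
        unfolding D_def by (intro prod.cong) auto
      also have "\<dots> = (54 * \<eta> / (\<sigma> * \<delta>)) ^ CARD('m) * ((\<Prod>j\<in>UNIV. r' j) / (\<Prod>j\<in>UNIV. r j))"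
        by (subst prod.distrib) (simp add: prod_dividef)
      finally show ?thesis .
    qed
    have 2: "(\<Prod>l\<in>UNIV. 3 * Y l) = (3 * \<eta> / \<delta>) ^ CARD('n) * ((\<Prod>k\<in>UNIV. R' k) / (\<Prod>k\<in>UNIV. R k))"
    proof -
      have "(\<Prod>l\<in>UNIV. 3 * Y l) = (\<Prod>l\<in>UNIV. (3 * \<eta> / \<delta>) * (R' l / R l))"
        unfolding Y_def by (intro prod.cong) auto
      also have "\<dots> = (3 * \<eta> / \<delta>) ^ CARD('n) * ((\<Prod>k\<in>UNIV. R' k) / (\<Prod>k\<in>UNIV. R k))"
        by (subst prod.distrib) (simp add: prod_dividef)
      finally show ?thesis .
    qed
    \<comment> \<open>The bound depends on the scales only through these two quotients, and both
      volumes are 1.\<close>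
    have 3: "((\<Prod>j\<in>UNIV. r' j) / (\<Prod>j\<in>UNIV. r j)) * ((\<Prod>k\<in>UNIV. R' k) / (\<Prod>k\<in>UNIV. R k)) = 1"
      using vol vol' by (simp flip: times_divide_times_eq)
    have "D * (\<Prod>l\<in>UNIV. 3 * Y l) = (54 * \<eta> / (\<sigma> * \<delta>)) ^ CARD('m) * (3 * \<eta> / \<delta>) ^ CARD('n) *
       (((\<Prod>j\<in>UNIV. r' j) / (\<Prod>j\<in>UNIV. r j)) * ((\<Prod>k\<in>UNIV. R' k) / (\<Prod>k\<in>UNIV. R k)))"
      unfolding 1 2 by (simp only: mult_ac)
    then show ?thesis unfolding 3 by simp
  qed
  have Wle: "?\<mu> W \<le> 3 * real CARD('n) * (54 * \<eta> / (\<sigma> * \<delta>)) ^ CARD('m) * (3 * \<eta> / \<delta>) ^ CARD('n) * ?\<mu> ?P"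
  proof -
    have "?\<mu> W \<le> (\<Sum>k\<in>UNIV. ?\<mu> (\<Union>b\<in>I k. \<Union>x\<in>V k b. Z x))"
      unfolding W_def by (rule measure_UNION_le) (simp, rule fmeasurableD, rule Im)
    also have "\<dots> \<le> real CARD('n) * (?\<mu> ?P * D * (3 * (\<Prod>l\<in>UNIV. 3 * Y l)))"
      using Ile by (intro sum_bounded_above) auto
    also have "\<dots> = 3 * real CARD('n) * (D * (\<Prod>l\<in>UNIV. 3 * Y l)) * ?\<mu> ?P" by (simp only: mult_ac)
    finally show ?thesis unfolding prods by (simp only: mult_ac)
  qed
  have sub: "{\<theta> \<in> ?P. \<not> good \<eta> r' R' \<theta>} \<subseteq> W"
  proof clarify
    fix \<theta> assume P: "\<theta> \<in> ?P" and nb: "\<not> good \<eta> r' R' \<theta>"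
    then obtain p q where p: "\<And>j. \<bar>lf \<theta> p q j\<bar> \<le> \<eta> * r' j" and q: "\<And>k. \<bar>real_of_int (q k)\<bar> \<le> \<eta> * R' k"
      and nz: "\<not> (p = (\<lambda>_. 0) \<and> q = (\<lambda>_. 0))"
      unfolding good_def by blast
    define g where "g k = \<bar>real_of_int (q k)\<bar> / R k" for k
    have "Max (range g) \<in> range g" by (rule Max_in) auto
    then obtain k where k: "Max (range g) = g k" by blast
    have gmax: "g l \<le> g k" for l unfolding k[symmetric] by (rule Max_ge) auto
    \<comment> \<open>Passing from \<theta> to \<open>\<theta>0\<close> costs at most
      \<open>CARD('n) * \<sigma> * g k * r j\<close>, hence at most half of
      \<open>g k * r j\<close>; the term with \<open>\<delta> / 2\<close> comes from
      \<open>rr\<close>.\<close>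
    have lb: "\<bar>lf \<theta>0 p q j\<bar> \<le> r j * (\<delta> / 2 + g k / 2)" for j
    proof -
      have "\<bar>lf \<theta> p q j - lf \<theta>0 p q j\<bar> \<le> (\<Sum>l\<in>UNIV. \<sigma> * r j / R l * \<bar>of_int (q l)\<bar>)"
        using lf_bound[OF P] by simp
      also have "\<dots> = (\<Sum>l\<in>UNIV. \<sigma> * r j * g l)" by (simp add: g_def)
      also have "\<dots> \<le> (\<Sum>l\<in>(UNIV::'n set). \<sigma> * r j * g k)"
        using gmax \<sigma> r[of j] by (intro sum_mono mult_left_mono) auto
      also have "\<dots> = r j * (real CARD('n) * \<sigma>) * g k" by simp
      also have "\<dots> \<le> r j * (1/2) * g k"
        using \<sigma> r[of j] R[of k] by (intro mult_right_mono mult_left_mono) (auto simp: g_def)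
      finally have "\<bar>lf \<theta>0 p q j\<bar> \<le> \<bar>lf \<theta> p q j\<bar> + r j * (1/2) * g k" by linarith
      also have "\<dots> \<le> \<delta> / 2 * r j + r j * (1/2) * g k" using p[of j] rr[of j] by linarith
      finally show ?thesis by (simp add: algebra_simps)
    qed
    \<comment> \<open>Otherwise \<open>(p, q)\<close> would be short for \<open>\<theta>0\<close>
      already at the old scale.\<close>
    have gk: "g k > \<delta>"
    proof (rule ccontr)
      assume "\<not> g k > \<delta>"
      then have gle: "g l \<le> \<delta>" for l using gmax[of l] by linarith
      have "\<bar>lf \<theta>0 p q j\<bar> \<le> \<delta> * r j" for j
      proof -
        have "r j * (\<delta> / 2 + g k / 2) \<le> r j * \<delta>" using gle[of k] r[of j] by (intro mult_left_mono) auto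
        then show ?thesis using lb[of j] by (simp add: mult.commute)
      qed
      moreover have "\<bar>real_of_int (q l)\<bar> \<le> \<delta> * R l" for l
        using gle[of l] R[of l] by (simp add: g_def pos_divide_le_eq)
      ultimately show False using gd nz unfolding good_def by blast
    qed
    define b where "b = \<lfloor>real_of_int (q k) / (\<delta> * R k)\<rfloor>"
    have "\<bar>lf \<theta>0 p q j\<bar> \<le> g k * r j" for j
    proof -
      have "r j * (\<delta> / 2 + g k / 2) \<le> r j * g k" using gk r[of j] by (intro mult_left_mono) auto
      then show ?thesis using lb[of j] by (simp add: mult.commute)
    qed
    then have V: "(p,q) \<in> V k b" using q gk by (auto simp: V_def b_def g_def)
    have "\<bar>real_of_int (q k) / (\<delta> * R k)\<bar> \<le> Y k"
      using q[of k] \<delta> R[of k] by (simp add: Y_def abs_mult divide_right_mono)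
    then have I: "b \<in> I k" unfolding I_def b_def atLeastAtMost_iff by linarith
    have "\<theta> \<in> Z (p,q)" using P p by (simp add: Z_def slab_def s_def)
    then show "\<theta> \<in> W" using V I unfolding W_def by blast
  qed
  show ?thesis using that[OF Wm sub Wle] .
qed

section \<open>Covering radius\<close>

text \<open>If a target \<open>w\<close> were far from the lattice, the segment from \<open>0\<close> to \<open>w\<close> would contain many points
  whose distances to the lattice differ pairwise by at least \<open>\<eta>\<close>, and small cubes around the lattice
  translates of these points would be disjoint, which contradicts the covolume being one.\<close>

lemma covering_radius:
  assumes \<eta>: "\<eta> > 0"
  shows "\<exists>C>0. \<forall>(r::'m::finite \<Rightarrow> real) (R::'n::finite \<Rightarrow> real) (\<theta>::real^'n^'m) x y.
      (\<forall>j. r j > 0) \<longrightarrow> (\<forall>k. R k > 0) \<longrightarrow> (\<Prod>j\<in>UNIV. r j) * (\<Prod>k\<in>UNIV. R k) = 1 \<longrightarrow> good \<eta> r R \<theta> \<longrightarrow>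
      (\<exists>p q. (\<forall>j. \<bar>lf \<theta> p q j - x j\<bar> \<le> C * r j) \<and> (\<forall>k. \<bar>real_of_int (q k) - y k\<bar> \<le> C * R k))"
proof -
  define d where "d = CARD('m + 'n)"
  \<comment> \<open>The count below places \<open>K + 1\<close> families of points where at most
    \<open>(2 / \<eta>) ^ d\<close> fit. The added 1 in \<open>C\<close> makes the infimum strictly
    less than \<open>C\<close>, so that an actual lattice vector can be chosen.\<close>
  define K where "K = nat \<lceil>(2 / \<eta>) ^ d\<rceil>"
  define C where "C = real K * (real d * \<eta>) + 1"
  have C0: "C > 0" using \<eta> by (simp add: C_def add_nonneg_pos)
  have d0: "d > 0" by (simp add: d_def)
  have "\<exists>p q. (\<forall>j. \<bar>lf \<theta> p q j - x j\<bar> \<le> C * r j) \<and> (\<forall>k. \<bar>real_of_int (q k) - y k\<bar> \<le> C * R k)"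
    if r: "\<And>j. r j > 0" and R: "\<And>k. R k > 0" and vol: "(\<Prod>j\<in>UNIV. r j) * (\<Prod>k\<in>UNIV. R k) = 1"
      and gd: "good \<eta> r R \<theta>"
    for r :: "'m \<Rightarrow> real" and R :: "'n \<Rightarrow> real" and \<theta> :: "real^'n^'m" and x y
  proof -
    \<comment> \<open>Passing from \<open>r'\<close>, \<open>R'\<close> to \<open>lam ^ CARD('n) * r'\<close>, \<open>R' / lam ^ CARD('m)\<close> keeps the volume, so the constant \<open>D\<close> does not
    depend on \<open>lam\<close> and a large \<open>lam\<close> turns \<open>D\<close> into \<open>e\<close>.\<close>
  define lam where "lam p q = (\<chi> i. case_sum (\<lambda>j. lf \<theta> p q j / r j) (\<lambda>k. real_of_int (q k) / R k) i)"
      for p q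
    \<comment> \<open>The lattice in rescaled coordinates. Its closure under addition enters through
      \<open>close\<close>: translating by a lattice vector does not increase the distance to the
      lattice.\<close>
    define \<Lambda> where "\<Lambda> = {u. \<exists>p q. u = lam p q}"
    define w :: "real^('m+'n)" where "w = (\<chi> i. case_sum (\<lambda>j. x j / r j) (\<lambda>k. y k / R k) i)"
    have lam_add: "lam p q + lam p' q' = lam (\<lambda>j. p j + p' j) (\<lambda>k. q k + q' k)" for p q p' q'
      by (auto simp: lam_def vec_eq_iff lf_add add_divide_distrib split: sum.splits)
    have lam_diff: "lam p q - lam p' q' = lam (\<lambda>j. p j - p' j) (\<lambda>k. q k - q' k)" for p q p' q'
      by (auto simp: lam_def vec_eq_iff lf_diff diff_divide_distrib split: sum.splits)
    have \<Lambda>_add: "u + v \<in> \<Lambda>" if "u \<in> \<Lambda>" "v \<in> \<Lambda>" for u v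
      using that lam_add unfolding \<Lambda>_def by blast
    have \<Lambda>_diff: "u - v \<in> \<Lambda>" if "u \<in> \<Lambda>" "v \<in> \<Lambda>" for u v
      using that lam_diff unfolding \<Lambda>_def by blast
    have zero: "0 \<in> \<Lambda>"
      using \<Lambda>_diff[of "lam (\<lambda>_. 0) (\<lambda>_. 0)" "lam (\<lambda>_. 0) (\<lambda>_. 0)"] by (auto simp: \<Lambda>_def)
    have ne: "\<Lambda> \<noteq> {}" using zero by auto
    have "infdist w \<Lambda> \<le> real K * (real d * \<eta>)"
    proof (rule ccontr)
      assume far: "\<not> ?thesis"
      \<comment> \<open>The distance to \<open>\<Lambda>\<close> is continuous along the segment,
        vanishes at the origin and exceeds \<open>K * d * \<eta>\<close> at \<open>w\<close>, so it
        takes each value \<open>i * d * \<eta>\<close> with \<open>i \<le> K\<close>.\<close>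
      have "\<exists>t. 0 \<le> t \<and> t \<le> 1 \<and> infdist (t *\<^sub>R w) \<Lambda> = real i * (real d * \<eta>)" if "i \<le> K" for i
      proof (rule IVT')
        show "infdist (0 *\<^sub>R w) \<Lambda> \<le> real i * (real d * \<eta>)" using zero \<eta> by simp
        have "real i * (real d * \<eta>) \<le> real K * (real d * \<eta>)"
          using that \<eta> by (intro mult_right_mono) auto
        then show "real i * (real d * \<eta>) \<le> infdist (1 *\<^sub>R w) \<Lambda>" using far by simp
      qed (auto intro!: continuous_intros)
      then obtain t where t: "\<And>i. i \<le> K \<Longrightarrow> 0 \<le> t i \<and> t i \<le> 1 \<and> infdist (t i *\<^sub>R w) \<Lambda> = real i * (real d * \<eta>)"
        by metis
      define g where "g q j = (\<Sum>k\<in>UNIV. \<theta>$j$k * of_int (q k))" for q j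
      \<comment> \<open>A window so large that the enlargement caused by \<open>w\<close> and by the
        cell size \<open>\<eta>\<close> at most doubles each of its sides. Its size cancels at the
        end.\<close>
      obtain X :: nat where X: "X > 0" "\<And>j. r j * (2 * \<bar>w $ Inl j\<bar> + \<eta>) \<le> X" "\<And>k. R k * (2 * \<bar>w $ Inr k\<bar> + \<eta>) \<le> X"
      proof -
        define c where "c = (\<Sum>j\<in>UNIV. r j * (2 * \<bar>w $ Inl j\<bar> + \<eta>)) + (\<Sum>k\<in>UNIV. R k * (2 * \<bar>w $ Inr k\<bar> + \<eta>)) + 1"
        have n1: "0 \<le> r j * (2 * \<bar>w $ Inl j\<bar> + \<eta>)" for j using r[of j] \<eta> by simp
        have n2: "0 \<le> R k * (2 * \<bar>w $ Inr k\<bar> + \<eta>)" for k using R[of k] \<eta> by simp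
        have "r j * (2 * \<bar>w $ Inl j\<bar> + \<eta>) \<le> (\<Sum>j\<in>UNIV. r j * (2 * \<bar>w $ Inl j\<bar> + \<eta>))" for j
          using n1 by (intro member_le_sum) auto
        moreover have "R k * (2 * \<bar>w $ Inr k\<bar> + \<eta>) \<le> (\<Sum>k\<in>UNIV. R k * (2 * \<bar>w $ Inr k\<bar> + \<eta>))" for k
          using n2 by (intro member_le_sum) auto
        moreover have "0 \<le> (\<Sum>j\<in>UNIV. r j * (2 * \<bar>w $ Inl j\<bar> + \<eta>))" "0 \<le> (\<Sum>k\<in>UNIV. R k * (2 * \<bar>w $ Inr k\<bar> + \<eta>))"
          using n1 n2 by (auto intro: sum_nonneg)
        ultimately have "c \<ge> 1" "\<And>j. r j * (2 * \<bar>w $ Inl j\<bar> + \<eta>) \<le> c" "\<And>k. R k * (2 * \<bar>w $ Inr k\<bar> + \<eta>) \<le> c"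
          unfolding c_def by (smt (verit))+
        moreover have "c \<le> real (nat \<lceil>c\<rceil>)" by linarith
        ultimately show ?thesis using that[of "nat \<lceil>c\<rceil>"] by (smt (verit) of_nat_0_less_iff)
      qed
      define A where "A = (PiE UNIV (\<lambda>_. {..<X}) :: ('m \<Rightarrow> nat) set)"
      define B where "B = (PiE UNIV (\<lambda>_. {..<X}) :: ('n \<Rightarrow> nat) set)"
      define S where "S = {..K} \<times> (A \<times> B)"
      define qq where "qq b = (\<lambda>k::'n. int (b k))" for b
      \<comment> \<open>Subtracting the floor puts the \<open>j\<close>-th form between
        \<open>a j\<close> and \<open>a j + 1\<close>, so the pairs \<open>(a, b)\<close> index
        \<open>X ^ d\<close> lattice vectors inside the window.\<close>
      define pp where "pp a b = (\<lambda>j::'m. int (a j) - \<lfloor>g (qq b) j\<rfloor>)" for a b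
      define f where "f = (\<lambda>(i,a,b) l. (t i *\<^sub>R w + lam (pp a b) (qq b)) $ l)"
      define lo where "lo l = - \<bar>w $ l\<bar>" for l
      define len where "len = case_sum (\<lambda>j. 2 * \<bar>w $ Inl j\<bar> + X / r j) (\<lambda>k. 2 * \<bar>w $ Inr k\<bar> + X / R k)"
      have rng: "lo l \<le> f z l \<and> f z l \<le> lo l + len l" if z: "z \<in> S" for z l
      proof -
        obtain i a b where iab: "z = (i,a,b)" by (cases z)
        have i: "i \<le> K" and ab: "\<And>j. a j < X" "\<And>k. b k < X" using z by (auto simp: S_def A_def B_def iab PiE_def Pi_def)
        have "\<bar>t i * w $ l\<bar> \<le> \<bar>w $ l\<bar>" using t[OF i] by (simp add: abs_mult mult_left_le_one_le)
        then have tw: "- \<bar>w $ l\<bar> \<le> t i * w $ l" "t i * w $ l \<le> \<bar>w $ l\<bar>" by linarith+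
        show ?thesis
        proof (cases l)
          case (Inl j)
          have "lf \<theta> (pp a b) (qq b) j = real (a j) + (g (qq b) j - of_int \<lfloor>g (qq b) j\<rfloor>)"
            by (simp add: lf_def pp_def g_def)
          moreover have "real (a j) + 1 \<le> real X" using ab(1)[of j] by linarith
          ultimately have "0 \<le> lf \<theta> (pp a b) (qq b) j" "lf \<theta> (pp a b) (qq b) j \<le> X" by linarith+
          then have "0 \<le> lf \<theta> (pp a b) (qq b) j / r j" "lf \<theta> (pp a b) (qq b) j / r j \<le> X / r j"
            using r[of j] by (auto intro: divide_right_mono simp: less_imp_le)
          then show ?thesis using tw by (simp add: Inl iab f_def lo_def len_def lam_def)
        next
          case (Inr k)
          have "real (b k) \<le> real X" using ab(2)[of k] by simp
          then have "0 \<le> real (b k) / R k" "real (b k) / R k \<le> X / R k"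
            using R[of k] by (auto intro: divide_right_mono simp: less_imp_le)
          then show ?thesis using tw by (simp add: Inr iab f_def lo_def len_def lam_def qq_def)
        qed
      qed
      \<comment> \<open>Points that agree modulo \<open>\<Lambda>\<close> up to
        \<open>\<eta>\<close> in each coordinate have distances to \<open>\<Lambda>\<close>
        differing by less than \<open>d * \<eta>\<close>, by comparison with the l1 norm. This keeps
        different values of \<open>i\<close> apart.\<close>
      have close: "infdist u \<Lambda> < infdist v \<Lambda> + real d * \<eta>"
        if "\<mu> \<in> \<Lambda>" "\<And>l. \<bar>(u - v - \<mu>) $ l\<bar> < \<eta>" for u v \<mu>
      proof -
        have "norm (u - v - \<mu>) \<le> (\<Sum>l\<in>UNIV. \<bar>(u - v - \<mu>) $ l\<bar>)" by (rule norm_le_l1_cart)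
        also have "\<dots> < (\<Sum>l\<in>(UNIV::('m+'n) set). \<eta>)" using that(2) by (intro sum_strict_mono) auto
        also have "\<dots> = real d * \<eta>" by (simp add: d_def)
        finally have n: "norm (u - v - \<mu>) < real d * \<eta>" .
        have "infdist u \<Lambda> \<le> infdist (v + \<mu>) \<Lambda> + dist u (v + \<mu>)" by (rule infdist_triangle)
        moreover have "infdist (v + \<mu>) \<Lambda> \<le> infdist v \<Lambda>"
          unfolding infdist_notempty[OF ne]
        proof (rule cINF_greatest[OF ne])
          fix z assume "z \<in> \<Lambda>"
          then have "z + \<mu> \<in> \<Lambda>" using that(1) by (rule \<Lambda>_add)
          then have "(INF a\<in>\<Lambda>. dist (v + \<mu>) a) \<le> dist (v + \<mu>) (z + \<mu>)"
            by (intro cINF_lower) (auto intro: bdd_belowI2[of _ 0])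
          then show "(INF a\<in>\<Lambda>. dist (v + \<mu>) a) \<le> dist v z" by simp
        qed
        moreover have "dist u (v + \<mu>) = norm (u - v - \<mu>)" by (simp add: dist_norm algebra_simps)
        ultimately show ?thesis using n by linarith
      qed
      have sep: "z = z'" if z: "z \<in> S" "z' \<in> S" and cl: "\<forall>l. \<bar>f z l - f z' l\<bar> < \<eta>" for z z'
      proof -
        obtain i a b i' a' b' where iab: "z = (i,a,b)" "z' = (i',a',b')" by (cases z, cases z')
        have i: "i \<le> K" "i' \<le> K" using z by (auto simp: S_def iab)
        let ?l = "lam (pp a b) (qq b)" and ?l' = "lam (pp a' b') (qq b')"
        have L: "?l \<in> \<Lambda>" "?l' \<in> \<Lambda>" by (auto simp: \<Lambda>_def)
        have dd: "\<bar>(t i *\<^sub>R w - t i' *\<^sub>R w - (?l' - ?l)) $ l\<bar> < \<eta>" "\<bar>(t i' *\<^sub>R w - t i *\<^sub>R w - (?l - ?l')) $ l\<bar> < \<eta>" for l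
          using cl[rule_format, of l] by (simp_all add: f_def iab algebra_simps)
        have "real i * (real d * \<eta>) < real i' * (real d * \<eta>) + real d * \<eta>"
          using close[OF \<Lambda>_diff[OF L(2,1)] dd(1)] t[OF i(1)] t[OF i(2)] by simp
        then have "real i * (real d * \<eta>) < (real i' + 1) * (real d * \<eta>)" by (simp add: algebra_simps)
        then have 1: "real i < real i' + 1" using \<eta> d0 by (simp add: mult_less_cancel_right)
        have "real i' * (real d * \<eta>) < real i * (real d * \<eta>) + real d * \<eta>"
          using close[OF \<Lambda>_diff[OF L(1,2)] dd(2)] t[OF i(1)] t[OF i(2)] by simp
        then have "real i' * (real d * \<eta>) < (real i + 1) * (real d * \<eta>)" by (simp add: algebra_simps)
        then have 2: "real i' < real i + 1" using \<eta> d0 by (simp add: mult_less_cancel_right)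
        have ii: "i = i'" using 1 2 by linarith
        have scale: "\<bar>x - y\<bar> \<le> \<eta> * c" if "\<bar>x / c - y / c\<bar> < \<eta>" "c > 0" for x y c :: real
        proof -
          have "\<bar>x - y\<bar> / c < \<eta>" using that by (simp flip: diff_divide_distrib)
          then show ?thesis using that by (simp add: pos_divide_less_eq)
        qed
        have "\<bar>lf \<theta> (pp a b) (qq b) j - lf \<theta> (pp a' b') (qq b') j\<bar> \<le> \<eta> * r j" for j
          using scale cl[rule_format, of "Inl j"] r[of j] by (simp add: iab ii f_def lam_def)
        moreover have "\<bar>real_of_int (qq b k) - real_of_int (qq b' k)\<bar> \<le> \<eta> * R k" for k
          using scale cl[rule_format, of "Inr k"] R[of k] by (simp add: iab ii f_def lam_def)
        ultimately have pq: "pp a b = pp a' b'" "qq b = qq b'" using goodD[OF gd] by metis+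
        then have "b = b'" by (auto simp: qq_def fun_eq_iff)
        moreover have "a = a'" using pq \<open>b = b'\<close> by (auto simp: pp_def fun_eq_iff)
        ultimately show ?thesis using ii iab by simp
      qed
      have len0: "len l \<ge> 0" for l
        using r R by (auto simp: len_def less_imp_le split: sum.splits)
      have "real (card S) \<le> (\<Prod>l\<in>UNIV. len l / \<eta> + 1)"
        by (rule card_separated_le(2)[of \<eta> S lo f len]) (fact \<eta>, erule rng, erule (2) sep, rule len0)
      also have "\<dots> \<le> (\<Prod>j\<in>UNIV. 2 * X / \<eta> / r j) * (\<Prod>k\<in>UNIV. 2 * X / \<eta> / R k)"
        unfolding prod_UNIV_sum
      proof (intro mult_mono prod_mono prod_nonneg)
        fix j
        have "len (Inl j) / \<eta> + 1 = (r j * (2 * \<bar>w $ Inl j\<bar> + \<eta>) + X) / (\<eta> * r j)"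
          using \<eta> r[of j] by (simp add: len_def field_simps)
        also have "\<dots> \<le> (X + X) / (\<eta> * r j)"
          using X(2)[of j] \<eta> r[of j] by (intro divide_right_mono) auto
        finally show "0 \<le> len (Inl j) / \<eta> + 1 \<and> len (Inl j) / \<eta> + 1 \<le> 2 * X / \<eta> / r j"
          using len0[of "Inl j"] \<eta> by simp
        show "0 \<le> 2 * X / \<eta> / r j" using \<eta> r[of j] by simp
      next
        fix k
        have "len (Inr k) / \<eta> + 1 = (R k * (2 * \<bar>w $ Inr k\<bar> + \<eta>) + X) / (\<eta> * R k)"
          using \<eta> R[of k] by (simp add: len_def field_simps)
        also have "\<dots> \<le> (X + X) / (\<eta> * R k)"
          using X(3)[of k] \<eta> R[of k] by (intro divide_right_mono) auto
        finally show "0 \<le> len (Inr k) / \<eta> + 1 \<and> len (Inr k) / \<eta> + 1 \<le> 2 * X / \<eta> / R k"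
          using len0[of "Inr k"] \<eta> by simp
        show "0 \<le> len (Inr k) / \<eta> + 1" using len0[of "Inr k"] \<eta> by simp
      qed
      \<comment> \<open>Unimodularity removes \<open>r\<close> and \<open>R\<close> from the bound,
        so \<open>C\<close> depends only on \<open>\<eta>\<close> and the dimension.\<close>
      also have "\<dots> = (2 * X / \<eta>) ^ d"
      proof -
        have "(\<Prod>j\<in>UNIV. 2 * X / \<eta> / r j) = (2 * X / \<eta>) ^ CARD('m) / (\<Prod>j\<in>UNIV. r j)"
          by (subst prod_dividef) simp
        moreover have "(\<Prod>k\<in>UNIV. 2 * X / \<eta> / R k) = (2 * X / \<eta>) ^ CARD('n) / (\<Prod>k\<in>UNIV. R k)"
          by (subst prod_dividef) simp
        ultimately show ?thesis using vol by (simp add: d_def power_add)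
      qed
      also have "\<dots> = (2 / \<eta>) ^ d * real X ^ d" by (simp add: power_divide power_mult_distrib)
      finally have "real (card S) \<le> (2 / \<eta>) ^ d * real X ^ d" .
      moreover have "card S = (K + 1) * X ^ d"
        by (simp add: S_def A_def B_def card_PiE card_cartesian_product d_def power_add)
      ultimately have "real (K + 1) * real X ^ d \<le> (2 / \<eta>) ^ d * real X ^ d" by (simp add: distrib_right)
      then have "real (K + 1) \<le> (2 / \<eta>) ^ d" using X(1) by (simp add: mult_le_cancel_right)
      then show False unfolding K_def by linarith
    qed
    then have "infdist w \<Lambda> < C" by (simp add: C_def)
    then obtain u where u: "u \<in> \<Lambda>" "dist w u < C"
      unfolding infdist_notempty[OF ne] by (subst (asm) cINF_less_iff[OF ne]) (auto intro: bdd_belowI2[of _ 0])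
    then obtain p q where pq: "u = lam p q" by (auto simp: \<Lambda>_def)
    have comp: "\<bar>u $ l - w $ l\<bar> \<le> C" for l
    proof -
      have "\<bar>(u - w) $ l\<bar> \<le> norm (u - w)" by (rule component_le_norm_cart)
      then show ?thesis using u(2) by (simp add: dist_norm norm_minus_commute)
    qed
    have scale: "\<bar>x - y\<bar> \<le> C * c" if "\<bar>x / c - y / c\<bar> \<le> C" "c > 0" for x y c :: real
    proof -
      have "\<bar>x - y\<bar> / c \<le> C" using that by (simp flip: diff_divide_distrib)
      then show ?thesis using that by (simp add: pos_divide_le_eq)
    qed
    have "\<bar>lf \<theta> p q j - x j\<bar> \<le> C * r j" for j
      using scale comp[of "Inl j"] r[of j] by (simp add: pq lam_def w_def)
    moreover have "\<bar>real_of_int (q k) - y k\<bar> \<le> C * R k" for k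
      using scale comp[of "Inr k"] R[of k] by (simp add: pq lam_def w_def)
    ultimately show ?thesis by blast
  qed
  with C0 show ?thesis by blast
qed

section \<open>Packing by disjoint boxes and perturbation to exact solutions\<close>

text \<open>Disjoint sets of equal positive measure inside \<open>P\<close> are bounded in number,
  so a disjoint family of largest cardinality exists. A set disjoint from all its members would be
  nonempty, hence new, and would enlarge it.\<close>

lemma maximal_disjoint_family:
  fixes T :: "'a \<Rightarrow> 'b::euclidean_space set"
  assumes T: "\<And>a. a \<in> A \<Longrightarrow> T a \<in> lmeasurable" "\<And>a. a \<in> A \<Longrightarrow> measure lebesgue (T a) = \<mu>" "\<mu> > 0"
    and P: "P \<in> lmeasurable" "\<And>a. a \<in> A \<Longrightarrow> T a \<subseteq> P"
  obtains X where "finite X" "X \<subseteq> A" "pairwise (\<lambda>a b. disjnt (T a) (T b)) X"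
    "\<And>a. a \<in> A \<Longrightarrow> \<exists>x\<in>X. \<not> disjnt (T a) (T x)"
proof -
  define F where "F X \<longleftrightarrow> finite X \<and> X \<subseteq> A \<and> pairwise (\<lambda>a b. disjnt (T a) (T b)) X" for X
  have bnd: "card X \<le> nat \<lceil>measure lebesgue P / \<mu>\<rceil>" if X: "F X" for X
  proof -
    have m: "\<And>a. a \<in> X \<Longrightarrow> T a \<in> lmeasurable" and fin: "finite X" using X T(1) by (auto simp: F_def)
    have "real (card X) * \<mu> = (\<Sum>a\<in>X. measure lebesgue (T a))"
      using X T(2) by (auto simp: F_def subset_eq)
    also have "\<dots> = measure lebesgue (\<Union>a\<in>X. T a)"
      using X m by (intro measure_UNION'[symmetric]) (auto simp: F_def)
    also have "\<dots> \<le> measure lebesgue P"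
      using X P m fin by (intro measure_mono_fmeasurable) (auto simp: F_def intro!: fmeasurableD)
    finally have "real (card X) \<le> measure lebesgue P / \<mu>" using T(3) by (simp add: pos_le_divide_eq)
    then show ?thesis by linarith
  qed
  have "F {}" by (simp add: F_def)
  then obtain X where X: "F X" "\<And>Y. F Y \<Longrightarrow> card Y \<le> card X"
    using ex_has_greatest_nat[of F "{}" card "Suc (nat \<lceil>measure lebesgue P / \<mu>\<rceil>)"] bnd by (metis le_imp_less_Suc)
  have "\<exists>x\<in>X. \<not> disjnt (T a) (T x)" if a: "a \<in> A" for a
  proof (rule ccontr)
    assume c: "\<not> ?thesis"
    have "T a \<noteq> {}" using T(2,3) a by force
    then have "a \<notin> X" using c by (auto simp: disjnt_def)
    moreover have "F (insert a X)"
      using c a X(1) by (auto simp: F_def pairwise_insert disjnt_sym)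
    ultimately show False using X(2)[of "insert a X"] X(1) by (auto simp: F_def)
  qed
  with X(1) show ?thesis using that[of X] by (auto simp: F_def)
qed

lemma measure_mbox:
  assumes "\<And>j. r j > 0" "\<And>k. R k > 0" "\<sigma> \<ge> 0"
  shows "measure lebesgue (mbox (\<theta>::real^'n^'m) \<sigma> r R)
    = (2 * \<sigma>) ^ (CARD('m) * CARD('n)) * (\<Prod>j\<in>UNIV. \<Prod>k\<in>UNIV. r j / R k)"
proof -
  have "measure lebesgue (mbox \<theta> \<sigma> r R) = (\<Prod>j\<in>UNIV. \<Prod>k\<in>UNIV. 2 * (\<sigma> * r j / R k))"
    using assms by (intro measure_gbox) (auto simp: less_imp_le)
  also have "\<dots> = (\<Prod>j\<in>(UNIV::'m set). \<Prod>k\<in>(UNIV::'n set). 2 * \<sigma>) * (\<Prod>j\<in>UNIV. \<Prod>k\<in>UNIV. r j / R k)"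
    by (subst prod.distrib[symmetric])+ (auto intro!: prod.cong)
  also have "(\<Prod>j\<in>(UNIV::'m set). \<Prod>k\<in>(UNIV::'n set). 2 * \<sigma>) = (2 * \<sigma>) ^ (CARD('m) * CARD('n))"
    by (simp only: prod_constant power_mult[symmetric]) (simp add: mult.commute)
  finally show ?thesis .
qed

lemma mbox_rescale:
  assumes "l > 0" "h > 0"
  shows "mbox \<theta> \<sigma> (\<lambda>j. l * r j) (\<lambda>k. R k / h) = mbox \<theta> (\<sigma> * l * h) r R"
  using assms by (simp add: gbox_def field_simps)

lemma mbox_mono:
  assumes "\<theta>1 \<in> mbox \<theta>0 a r R" "a + b \<le> c" "\<And>j. r j > 0" "\<And>k. R k > 0"
  shows "mbox \<theta>1 b r R \<subseteq> mbox \<theta>0 c r R"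
proof
  fix \<theta> assume "\<theta> \<in> mbox \<theta>1 b r R"
  then have "\<bar>\<theta>$j$k - \<theta>0$j$k\<bar> \<le> (a + b) * (r j / R k)" for j k
  proof -
    have "\<bar>\<theta>$j$k - \<theta>1$j$k\<bar> \<le> b * r j / R k" "\<bar>\<theta>1$j$k - \<theta>0$j$k\<bar> \<le> a * r j / R k"
      using assms(1) \<open>\<theta> \<in> mbox \<theta>1 b r R\<close> by (auto simp: gbox_def)
    then show ?thesis by (simp add: distrib_right add_divide_distrib)
  qed
  moreover have "(a + b) * (r j / R k) \<le> c * (r j / R k)" for j k
    using assms(2-4) by (intro mult_right_mono) (auto simp: less_imp_le)
  ultimately have "\<bar>\<theta>$j$k - \<theta>0$j$k\<bar> \<le> c * (r j / R k)" for j k by (meson order_trans)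
  then show "\<theta> \<in> mbox \<theta>0 c r R" by (simp add: gbox_def)
qed

text \<open>The residue class is the coset \<open>v + N * (z, y)\<close>, and the covering property
  finds in it a vector with small forms and large entries \<open>q k\<close>. Dividing the forms by
  one large entry gives a small change of one column that makes them vanish. This change moves the
  forms at a short vector by at most \<open>\<eta> / 2 * r j\<close>, which costs half of the
  goodness.\<close>

lemma perturb_to_solution:
  fixes \<theta> :: "real^'n^'m" and vp :: "'m \<Rightarrow> int" and vq :: "'n \<Rightarrow> int"
  assumes r: "\<And>j. r j > 0" and R: "\<And>k. R k > 0" and C: "C > 0" and N: "N \<ge> (1::int)" and gd: "good \<eta> r R \<theta>"
    and cov: "\<And>x y. \<exists>p q. (\<forall>j. \<bar>lf \<theta> p q j - x j\<bar> \<le> C * r j) \<and> (\<forall>k. \<bar>real_of_int (q k) - y k\<bar> \<le> C * R k)"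
  obtains \<theta>1 p q where "\<theta>1 \<in> mbox \<theta> 1 r R" "good (\<eta> / 2) r R \<theta>1"
    "\<And>j. [p j = vp j] (mod N)" "\<And>k. [q k = vq k] (mod N)"
    "\<And>j. lf \<theta>1 p q j = 0" "\<And>k. \<bar>real_of_int (q k)\<bar> \<le> 3 * of_int N * C * R k"
proof -
  have N0: "real_of_int N > 0" using N by simp
  \<comment> \<open>The target for \<open>y\<close> is shifted by \<open>2 * C * R k\<close>, so
    that the error \<open>C * R k\<close> leaves \<open>q k\<close> between
    \<open>N * C * R k\<close> and \<open>3 * N * C * R k\<close>; the lower bound keeps the later
    division harmless.\<close>
  obtain z y where z: "\<And>j. \<bar>lf \<theta> z y j - (- (lf \<theta> vp vq j) / of_int N)\<bar> \<le> C * r j"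
    and y: "\<And>k. \<bar>real_of_int (y k) - (2 * C * R k - of_int (vq k) / of_int N)\<bar> \<le> C * R k"
    using cov[of "\<lambda>j. - (lf \<theta> vp vq j) / of_int N" "\<lambda>k. 2 * C * R k - of_int (vq k) / of_int N"] by blast
  define p where "p = (\<lambda>j. vp j + N * z j)"
  define q where "q = (\<lambda>k. vq k + N * y k)"
  have lfp: "\<bar>lf \<theta> p q j\<bar> \<le> of_int N * (C * r j)" for j
  proof -
    have "lf \<theta> p q j = of_int N * lf \<theta> z y j + lf \<theta> vp vq j"
      by (simp add: p_def q_def lf_def sum.distrib sum_distrib_left algebra_simps)
    also have "\<dots> = of_int N * (lf \<theta> z y j - (- (lf \<theta> vp vq j) / of_int N))"
      using N0 by (simp add: distrib_left)
    finally have "lf \<theta> p q j = \<dots>" .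
    then have "\<bar>lf \<theta> p q j\<bar> = of_int N * \<bar>lf \<theta> z y j - (- (lf \<theta> vp vq j) / of_int N)\<bar>"
      using N0 by (simp add: abs_mult)
    then show ?thesis using z[of j] N0 by (simp add: mult_left_mono)
  qed
  have qb: "of_int N * (C * R k) \<le> of_int (q k)" "of_int (q k) \<le> 3 * of_int N * C * R k" for k
  proof -
    have e: "real_of_int (q k) = of_int N * (of_int (vq k) / of_int N + of_int (y k))"
      using N0 by (simp add: q_def algebra_simps)
    have "C * R k \<le> of_int (vq k) / of_int N + of_int (y k)" "of_int (vq k) / of_int N + of_int (y k) \<le> 3 * (C * R k)"
      using y[of k] by linarith+
    then have "of_int N * (C * R k) \<le> of_int (q k)" "of_int (q k) \<le> of_int N * (3 * (C * R k))"
      unfolding e using N0 by (intro mult_left_mono; simp)+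
    then show "of_int N * (C * R k) \<le> of_int (q k)" "of_int (q k) \<le> 3 * of_int N * C * R k" by (simp_all add: mult_ac)
  qed
  have NCR: "of_int N * (C * R k) > 0" for k using N0 C R[of k] by simp
  have qpos: "real_of_int (q k) > 0" for k using qb(1)[of k] NCR[of k] by linarith
  \<comment> \<open>Any column will do, since every \<open>q k\<close> is large.\<close>
  define k0 :: 'n where "k0 = (SOME k. True)"
  define \<phi> where "\<phi> j = - lf \<theta> p q j / of_int (q k0)" for j
  define \<theta>1 where "\<theta>1 = \<theta> + (\<chi> j k. if k = k0 then \<phi> j else 0)"
  have \<phi>: "\<bar>\<phi> j\<bar> \<le> r j / R k0" for j
  proof -
    have "\<bar>\<phi> j\<bar> = \<bar>lf \<theta> p q j\<bar> / of_int (q k0)" using qpos[of k0] by (simp add: \<phi>_def)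
    also have "\<dots> \<le> of_int N * (C * r j) / (of_int N * (C * R k0))"
      using lfp[of j] qb(1)[of k0] NCR[of k0] by (intro frac_le) auto
    also have "\<dots> = r j / R k0" using N0 C by simp
    finally show ?thesis .
  qed
  have lf1: "lf \<theta>1 p' q' j = lf \<theta> p' q' j + \<phi> j * of_int (q' k0)" for p' q' j
  proof -
    have "(\<Sum>k\<in>UNIV. (\<chi> j k. if k = k0 then \<phi> j else 0) $ j $ k * of_int (q' k))
       = (\<Sum>k\<in>UNIV. if k = k0 then \<phi> j * of_int (q' k0) else 0)" by (intro sum.cong) auto
    then show ?thesis unfolding \<theta>1_def lf_add_matrix by simp
  qed
  show ?thesis
  proof (rule that)
    have "\<bar>\<theta>1$j$k - \<theta>$j$k\<bar> \<le> 1 * r j / R k" for j k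
      using \<phi>[of j] r[of j] R[of k] by (simp add: \<theta>1_def)
    then show "\<theta>1 \<in> mbox \<theta> 1 r R" by (simp add: gbox_def)
    show "good (\<eta> / 2) r R \<theta>1"
      unfolding good_def
    proof (intro allI impI)
      fix p' q' assume p': "\<forall>j. \<bar>lf \<theta>1 p' q' j\<bar> \<le> \<eta> / 2 * r j" and q': "\<forall>k. \<bar>real_of_int (q' k)\<bar> \<le> \<eta> / 2 * R k"
      have \<eta>: "\<eta> \<ge> 0"
      proof -
        have "0 \<le> \<eta> / 2 * R k0" using q'[rule_format, of k0] by linarith
        then show ?thesis using R[of k0] by (simp add: zero_le_mult_iff)
      qed
      have "\<bar>lf \<theta> p' q' j\<bar> \<le> \<eta> * r j" for j
      proof -
        have "\<bar>\<phi> j * of_int (q' k0)\<bar> \<le> r j / R k0 * (\<eta> / 2 * R k0)"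
          unfolding abs_mult using \<phi>[of j] q' r[of j] R[of k0] by (intro mult_mono) (auto simp: less_imp_le)
        also have "\<dots> = \<eta> / 2 * r j" using R[of k0] by simp
        finally have "\<bar>\<phi> j * of_int (q' k0)\<bar> \<le> \<eta> / 2 * r j" .
        moreover have "\<bar>lf \<theta> p' q' j + \<phi> j * of_int (q' k0)\<bar> \<le> \<eta> / 2 * r j" using p' unfolding lf1 by blast
        ultimately show ?thesis by linarith
      qed
      moreover have "\<bar>real_of_int (q' k)\<bar> \<le> \<eta> * R k" for k
      proof -
        have "\<eta> * R k \<ge> 0" using \<eta> R[of k] by simp
        then show ?thesis using q'[rule_format, of k] by simp
      qed
      ultimately show "p' = (\<lambda>_. 0) \<and> q' = (\<lambda>_. 0)" using gd unfolding good_def by blast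
    qed
    show "lf \<theta>1 p q j = 0" for j unfolding lf1 \<phi>_def using qpos[of k0] by simp
    show "[p j = vp j] (mod N)" for j by (simp add: p_def cong_def)
    show "[q k = vq k] (mod N)" for k by (simp add: q_def cong_def)
    show "\<bar>real_of_int (q k)\<bar> \<le> 3 * of_int N * C * R k" for k using qb(2)[of k] qpos[of k] by linarith
  qed
qed

section \<open>From one level to the next\<close>

lemma gbox_mono: "(\<And>j k. s j k \<le> s' j k) \<Longrightarrow> gbox \<theta> s \<subseteq> gbox \<theta> s'"
  unfolding gbox_def by clarsimp (meson order_trans)

text \<open>The constants are chosen before the scales and the centre, which permits iteration. Good
  points fill half of a concentric box; boxes around a maximal disjoint selection of them occupy a
  fixed proportion, and each selected point is then moved to a solution within its own box.\<close>

lemma refine_good_box: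
  fixes vp :: "'m::finite \<Rightarrow> int" and vq :: "'n::finite \<Rightarrow> int" and N :: int
  assumes \<sigma>: "\<sigma> > 0" "real CARD('n) * \<sigma> \<le> 1/2" and \<delta>: "\<delta> > 0" and e: "e > 0" and N: "N \<ge> 1"
  shows "\<exists>\<tau>>0. \<exists>\<sigma>'>0. \<exists>\<delta>'>0. \<exists>c>0. real CARD('n) * \<sigma>' \<le> 1/2 \<and>
    (\<forall>r R r' R' (\<theta>0::real^'n^'m).
       (\<forall>j. r j > 0 \<and> r' j > 0 \<and> r' j \<le> \<tau> * r j) \<longrightarrow> (\<forall>k. R k > 0 \<and> R' k > 0 \<and> R k \<le> \<tau> * R' k) \<longrightarrow>
       (\<Prod>j\<in>UNIV. r j) * (\<Prod>k\<in>UNIV. R k) = 1 \<longrightarrow> (\<Prod>j\<in>UNIV. r' j) * (\<Prod>k\<in>UNIV. R' k) = 1 \<longrightarrow>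
       good \<delta> r R \<theta>0 \<longrightarrow>
       (\<exists>X. finite X \<and> pairwise (\<lambda>a b. disjnt (mbox a \<sigma>' r' R') (mbox b \<sigma>' r' R')) X \<and>
         c * measure lebesgue (mbox \<theta>0 \<sigma> r R) \<le> (\<Sum>\<theta>1\<in>X. measure lebesgue (mbox \<theta>1 \<sigma>' r' R')) \<and>
         (\<forall>\<theta>1\<in>X. good \<delta>' r' R' \<theta>1 \<and> mbox \<theta>1 \<sigma>' r' R' \<subseteq> mbox \<theta>0 \<sigma> r R \<and>
           (\<exists>p q. (\<forall>j. [p j = vp j] (mod N)) \<and> (\<forall>k. [q k = vq k] (mod N)) \<and>
              (\<forall>\<theta>\<in>mbox \<theta>1 \<sigma>' r' R'. \<forall>j. \<bar>lf \<theta> p q j\<bar> \<le> e * r' j) \<and>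
              (\<forall>k. \<bar>real_of_int (q k)\<bar> \<le> e * R' k)))))"
proof -
  let ?m = "CARD('m)" and ?n = "CARD('n)" and ?\<mu> = "measure lebesgue"
  define nn where "nn = real ?n"
  have nn: "nn \<ge> 1" by (simp add: nn_def Suc_le_eq)
  have m1: "?m \<ge> 1" by (simp add: Suc_le_eq)
  \<comment> \<open>With box parameter \<open>\<sigma> / 2\<close> the first moment bound is
    \<open>3 * nn * (a * \<eta>) ^ CARD('m) * (b * \<eta>) ^ CARD('n)\<close>. The choice of
    \<open>\<eta>\<close> makes \<open>b * \<eta> \<le> 1\<close> and
    \<open>6 * nn * a * \<eta> \<le> 1\<close>, so at most half of the box is bad.\<close>
  define a where "a = 108 / (\<sigma> * \<delta>)"
  define b where "b = 3 / \<delta>"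
  define \<eta> where "\<eta> = min (1 / b) (1 / (6 * nn * a))"
  have a: "a > 0" and b: "b > 0" using \<sigma> \<delta> by (auto simp: a_def b_def)
  have \<eta>: "\<eta> > 0" using a b nn by (simp add: \<eta>_def)
  have fm: "3 * nn * (54 * \<eta> / (\<sigma> / 2 * \<delta>)) ^ ?m * (3 * \<eta> / \<delta>) ^ ?n \<le> 1/2"
  proof -
    have "b * \<eta> \<le> b * (1 / b)" using b by (intro mult_left_mono) (auto simp: \<eta>_def)
    then have b1: "b * \<eta> \<le> 1" using b by simp
    have "6 * nn * a * \<eta> \<le> 6 * nn * a * (1 / (6 * nn * a))" using a nn by (intro mult_left_mono) (auto simp: \<eta>_def)
    then have a1: "6 * nn * (a * \<eta>) \<le> 1" using a nn by (simp add: mult.assoc)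
    have a0: "a * \<eta> \<ge> 0" using a \<eta> by simp
    have "1 * (a * \<eta>) \<le> 6 * nn * (a * \<eta>)" using a0 nn by (intro mult_right_mono) auto
    then have a2: "a * \<eta> \<le> 1" using a1 by simp
    have "(a * \<eta>) ^ ?m \<le> (a * \<eta>) ^ 1" using m1 a0 a2 by (intro power_decreasing) auto
    moreover have "(b * \<eta>) ^ ?n \<le> 1" using b \<eta> b1 by (intro power_le_one) auto
    ultimately have "(3 * nn * (a * \<eta>) ^ ?m) * (b * \<eta>) ^ ?n \<le> (3 * nn * (a * \<eta>)) * 1"
      using nn a a0 b \<eta> by (intro mult_mono mult_left_mono mult_nonneg_nonneg) auto
    also have "\<dots> \<le> 1/2" using a1 by simp
    finally show ?thesis by (simp add: a_def b_def mult_ac)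
  qed
  obtain C where C: "C > 0" and cov: "\<And>(r::'m \<Rightarrow> real) (R::'n \<Rightarrow> real) (\<theta>::real^'n^'m) x y.
      \<forall>j. r j > 0 \<Longrightarrow> \<forall>k. R k > 0 \<Longrightarrow> (\<Prod>j\<in>UNIV. r j) * (\<Prod>k\<in>UNIV. R k) = 1 \<Longrightarrow> good \<eta> r R \<theta> \<Longrightarrow>
      \<exists>p q. (\<forall>j. \<bar>lf \<theta> p q j - x j\<bar> \<le> C * r j) \<and> (\<forall>k. \<bar>real_of_int (q k) - y k\<bar> \<le> C * R k)"
    using covering_radius[OF \<eta>, where 'm='m and 'n='n] by metis
  define D where "D = 3 * of_int N * C"
  have D: "D > 0" using N C by (simp add: D_def)
  \<comment> \<open>\<open>perturb_to_solution\<close> bounds \<open>q k\<close> by \<open>D\<close>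
    times the scale, whereas \<open>e\<close> is wanted. Replacing \<open>r'\<close> by
    \<open>l * r'\<close> and \<open>R'\<close> by \<open>R' / h\<close> preserves the volume and
    leaves \<open>D\<close> unchanged; \<open>h \<ge> D / e\<close> then turns \<open>D\<close> into
    \<open>e\<close>.\<close>
  define lam where "lam = max 1 (D / e)"
  have lam: "lam \<ge> 1" by (simp add: lam_def)
  define l where "l = lam ^ ?n"
  define h where "h = lam ^ ?m"
  have l: "l \<ge> 1" and h: "h \<ge> 1" using lam by (auto simp: l_def h_def one_le_power)
  have "lam ^ 1 \<le> h" unfolding h_def using lam m1 by (intro power_increasing) auto
  then have "D / e \<le> h" by (simp add: lam_def)
  then have Dh: "D / h \<le> e" using e h by (simp add: field_simps)
  \<comment> \<open>The radius of the final boxes in rescaled units. The second entry keeps the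
    forms below \<open>e * r' j\<close> on the whole box, the third gives the condition on
    \<open>\<sigma>'\<close>, which is the same radius in units of \<open>r'\<close> and
    \<open>R'\<close>.\<close>
  define \<sigma>2 where "\<sigma>2 = min 1 (min (e / (nn * D * l)) (1 / (2 * nn * (l * h))))"
  have \<sigma>2: "\<sigma>2 > 0" "\<sigma>2 \<le> 1" using e nn D l h by (auto simp: \<sigma>2_def)
  have \<sigma>2e: "nn * \<sigma>2 * D * l \<le> e"
  proof -
    have "\<sigma>2 \<le> e / (nn * D * l)" by (simp add: \<sigma>2_def)
    then show ?thesis using nn D l by (simp add: pos_le_divide_eq mult_ac)
  qed
  define \<sigma>' where "\<sigma>' = \<sigma>2 * l * h"
  have \<sigma>': "\<sigma>' > 0" using \<sigma>2 l h by (simp add: \<sigma>'_def)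
  have \<sigma>'n: "nn * \<sigma>' \<le> 1/2"
  proof -
    have "\<sigma>2 \<le> 1 / (2 * nn * (l * h))" by (simp add: \<sigma>2_def)
    then show ?thesis using nn l h by (simp add: pos_le_divide_eq \<sigma>'_def mult_ac)
  qed
  define \<delta>' where "\<delta>' = \<eta> / 2 / h"
  have \<delta>': "\<delta>' > 0" using \<eta> h by (simp add: \<delta>'_def)
  \<comment> \<open>The second and third entries give the two scale conditions of
    \<open>measure_not_good_le\<close>; the first and last make the boxes of size 2 at the new scale
    fit into the margin \<open>\<sigma> / 2\<close>.\<close>
  define \<tau> where "\<tau> = min 1 (min (\<delta> / (2 * \<eta> * l)) (min (\<eta> / (\<delta> * h)) (\<sigma> / (4 * (l * h)))))"
  have \<tau>: "\<tau> > 0" using \<delta> \<eta> \<sigma> l h by (auto simp: \<tau>_def)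
  have \<tau>1: "\<tau> \<le> 1" and \<tau>2: "\<eta> * (l * \<tau>) \<le> \<delta> / 2" and \<tau>3: "\<delta> * \<tau> * h \<le> \<eta>" and \<tau>4: "2 * (l * h) * \<tau> \<le> \<sigma> / 2"
  proof -
    have t: "\<tau> \<le> \<delta> / (2 * \<eta> * l)" "\<tau> \<le> \<eta> / (\<delta> * h)" "\<tau> \<le> \<sigma> / (4 * (l * h))" by (auto simp: \<tau>_def)
    show "\<tau> \<le> 1" by (simp add: \<tau>_def)
    show "\<eta> * (l * \<tau>) \<le> \<delta> / 2" using t(1) \<eta> l by (simp add: pos_le_divide_eq mult_ac)
    show "\<delta> * \<tau> * h \<le> \<eta>" using t(2) \<delta> h by (simp add: pos_le_divide_eq mult_ac)
    show "2 * (l * h) * \<tau> \<le> \<sigma> / 2" using t(3) l h by (simp add: pos_le_divide_eq mult_ac)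
  qed
  define dd where "dd = ?m * ?n"
  \<comment> \<open>The factors come from shrinking boxes of size 4 to size
    \<open>\<sigma>2\<close>, from the good half, and from passing from \<open>\<sigma>\<close> to
    \<open>\<sigma> / 2\<close>.\<close>
  define c where "c = (\<sigma>2 / 4) ^ dd * (1/2) * (1/2) ^ dd"
  have c: "c > 0" using \<sigma>2 by (simp add: c_def)
  have main: "\<exists>X. finite X \<and> pairwise (\<lambda>a b. disjnt (mbox a \<sigma>' r' R') (mbox b \<sigma>' r' R')) X \<and>
         c * ?\<mu> (mbox \<theta>0 \<sigma> r R) \<le> (\<Sum>\<theta>1\<in>X. ?\<mu> (mbox \<theta>1 \<sigma>' r' R')) \<and>
         (\<forall>\<theta>1\<in>X. good \<delta>' r' R' \<theta>1 \<and> mbox \<theta>1 \<sigma>' r' R' \<subseteq> mbox \<theta>0 \<sigma> r R \<and>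
           (\<exists>p q. (\<forall>j. [p j = vp j] (mod N)) \<and> (\<forall>k. [q k = vq k] (mod N)) \<and>
              (\<forall>\<theta>\<in>mbox \<theta>1 \<sigma>' r' R'. \<forall>j. \<bar>lf \<theta> p q j\<bar> \<le> e * r' j) \<and>
              (\<forall>k. \<bar>real_of_int (q k)\<bar> \<le> e * R' k)))"
    if r: "\<And>j. r j > 0" and R: "\<And>k. R k > 0" and r': "\<And>j. r' j > 0" and R': "\<And>k. R' k > 0"
      and vol: "(\<Prod>j\<in>UNIV. r j) * (\<Prod>k\<in>UNIV. R k) = 1" and vol': "(\<Prod>j\<in>UNIV. r' j) * (\<Prod>k\<in>UNIV. R' k) = 1"
      and rr: "\<And>j. r' j \<le> \<tau> * r j" and RR: "\<And>k. R k \<le> \<tau> * R' k" and gd: "good \<delta> r R \<theta>0"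
    for r R r' R' and \<theta>0 :: "real^'n^'m"
  proof -
    define \<rho> where "\<rho> = (\<lambda>j. l * r' j)"
    define P where "P = (\<lambda>k. R' k / h)"
    have \<rho>: "\<rho> j > 0" for j using r' l by (simp add: \<rho>_def)
    have P: "P k > 0" for k using R' h by (simp add: P_def)
    have volP: "(\<Prod>j\<in>UNIV. \<rho> j) * (\<Prod>k\<in>UNIV. P k) = 1"
    proof -
      have "(\<Prod>j\<in>UNIV. \<rho> j) = l ^ ?m * (\<Prod>j\<in>UNIV. r' j)" by (simp add: \<rho>_def prod.distrib)
      moreover have "(\<Prod>k\<in>UNIV. P k) = (\<Prod>k\<in>UNIV. R' k) / h ^ ?n" by (simp add: P_def prod_dividef)
      moreover have "l ^ ?m = h ^ ?n" by (simp add: l_def h_def power_mult[symmetric] mult.commute)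
      ultimately show ?thesis using vol' h by simp
    qed
    have resc: "mbox \<theta> s \<rho> P = mbox \<theta> (s * l * h) r' R'" for \<theta> s
      unfolding \<rho>_def P_def using l h by (intro mbox_rescale) auto
    \<comment> \<open>The inner box leaves room for the boxes of size 2 around its points.\<close>
    let ?B = "mbox \<theta>0 (\<sigma> / 2) r R"
    obtain W where W: "W \<in> lmeasurable" "{\<theta> \<in> ?B. \<not> good \<eta> \<rho> P \<theta>} \<subseteq> W"
      "?\<mu> W \<le> 3 * real CARD('n) * (54 * \<eta> / (\<sigma> / 2 * \<delta>)) ^ ?m * (3 * \<eta> / \<delta>) ^ ?n * ?\<mu> ?B"
    proof (rule measure_not_good_le[of r R \<rho> P "\<sigma> / 2" \<delta> \<eta> \<theta>0])
      show "\<eta> * \<rho> j \<le> \<delta> / 2 * r j" for j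
      proof -
        have "\<eta> * \<rho> j \<le> \<eta> * (l * (\<tau> * r j))"
          unfolding \<rho>_def using \<eta> l rr[of j] by (intro mult_left_mono) auto
        also have "\<dots> = \<eta> * (l * \<tau>) * r j" by simp
        also have "\<dots> \<le> \<delta> / 2 * r j" using \<tau>2 r[of j] by (intro mult_right_mono) auto
        finally show ?thesis .
      qed
      show "\<delta> * R k \<le> \<eta> * P k" for k
      proof -
        have "\<delta> * R k \<le> \<delta> * (\<tau> * R' k)" using \<delta> RR[of k] by (intro mult_left_mono) auto
        also have "\<dots> = \<delta> * \<tau> * h * P k" using h by (simp add: P_def)
        also have "\<dots> \<le> \<eta> * P k" using \<tau>3 P[of k] by (intro mult_right_mono) auto
        finally show ?thesis .
      qed
      show "real ?n * (\<sigma> / 2) \<le> 1 / 2" using \<sigma> by simp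
    qed (use r R \<rho> P vol volP \<sigma> \<delta> \<eta> gd in auto)
    have "?\<mu> W \<le> 1/2 * ?\<mu> ?B"
    proof -
      have "3 * nn * (54 * \<eta> / (\<sigma> / 2 * \<delta>)) ^ ?m * (3 * \<eta> / \<delta>) ^ ?n * ?\<mu> ?B \<le> 1/2 * ?\<mu> ?B"
        using fm by (intro mult_right_mono) auto
      then show ?thesis using W(3) by (simp only: nn_def)
    qed
    define A where "A = {\<theta> \<in> ?B. good \<eta> \<rho> P \<theta>}"
    have sub2: "mbox \<theta> 2 \<rho> P \<subseteq> mbox \<theta>0 \<sigma> r R" if "\<theta> \<in> ?B" for \<theta>
    proof -
      have "2 * \<rho> j / P k \<le> \<sigma> / 2 * r j / R k" for j k
      proof -
        have "2 * \<rho> j / P k = 2 * (l * h) * (r' j / R' k)" using h by (simp add: \<rho>_def P_def)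
        also have "r' j / R' k \<le> (\<tau> * r j) / (R k / \<tau>)"
          using rr[of j] RR[of k] r'[of j] R'[of k] r[of j] R[of k] \<tau>
          by (intro frac_le) (auto simp: pos_divide_le_eq mult.commute)
        also have "(\<tau> * r j) / (R k / \<tau>) = \<tau> * (\<tau> * (r j / R k))" using \<tau> by simp
        also have "\<dots> \<le> 1 * (\<tau> * (r j / R k))"
          using \<tau>1 \<tau> r[of j] R[of k] by (intro mult_right_mono) auto
        also have "2 * (l * h) * (1 * (\<tau> * (r j / R k))) = 2 * (l * h) * \<tau> * (r j / R k)" by simp
        also have "\<dots> \<le> \<sigma> / 2 * (r j / R k)" using \<tau>4 r[of j] R[of k] by (intro mult_right_mono) auto
        finally show ?thesis using l h by (simp add: mult_left_mono)
      qed
      then have "mbox \<theta> 2 \<rho> P \<subseteq> mbox \<theta> (\<sigma> / 2) r R" by (rule gbox_mono)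
      also have "\<dots> \<subseteq> mbox \<theta>0 \<sigma> r R" using that r R by (intro mbox_mono[of _ _ "\<sigma> / 2"]) auto
      finally show ?thesis .
    qed
    define \<mu>0 where "\<mu>0 = (\<Prod>j\<in>UNIV. \<Prod>k\<in>UNIV. \<rho> j / P k)"
    have \<mu>0: "\<mu>0 > 0" unfolding \<mu>0_def using \<rho> P by (intro prod_pos) auto
    have mm: "?\<mu> (mbox \<theta> s \<rho> P) = (2 * s) ^ dd * \<mu>0" if "s \<ge> 0" for \<theta> :: "real^'n^'m" and s
      using measure_mbox[OF \<rho> P that, of \<theta>] by (simp add: dd_def \<mu>0_def)
    obtain X where X: "finite X" "X \<subseteq> A" "pairwise (\<lambda>a b. disjnt (mbox a 2 \<rho> P) (mbox b 2 \<rho> P)) X"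
      "\<And>a. a \<in> A \<Longrightarrow> \<exists>x\<in>X. \<not> disjnt (mbox a 2 \<rho> P) (mbox x 2 \<rho> P)"
    proof (rule maximal_disjoint_family[of A "\<lambda>a. mbox a 2 \<rho> P" "4 ^ dd * \<mu>0" "mbox \<theta>0 \<sigma> r R"])
      show "?\<mu> (mbox a 2 \<rho> P) = 4 ^ dd * \<mu>0" for a :: "real^'n^'m" using mm[of 2 a] by simp
      show "mbox a 2 \<rho> P \<subseteq> mbox \<theta>0 \<sigma> r R" if "a \<in> A" for a using sub2 that by (auto simp: A_def)
    qed (use \<mu>0 in auto)
    \<comment> \<open>By maximality the box of size 2 around a good point meets a selected one, so
      the point lies in the doubled selected box. This bounds \<open>card X\<close> from
      below.\<close>
    have cover: "?B \<subseteq> W \<union> (\<Union>x\<in>X. mbox x 4 \<rho> P)"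
    proof
      fix \<theta> assume th: "\<theta> \<in> ?B"
      show "\<theta> \<in> W \<union> (\<Union>x\<in>X. mbox x 4 \<rho> P)"
      proof (cases "good \<eta> \<rho> P \<theta>")
        case True
        then have "\<theta> \<in> A" using th by (simp add: A_def)
        then obtain x t where x: "x \<in> X" "t \<in> mbox \<theta> 2 \<rho> P" "t \<in> mbox x 2 \<rho> P"
          using X(4)[of \<theta>] by (auto simp: disjnt_def)
        have "\<theta> \<in> mbox t 2 \<rho> P" using x(2) by (simp add: gbox_def abs_minus_commute)
        then have "\<theta> \<in> mbox x 4 \<rho> P" using mbox_mono[OF x(3), of 2 4] \<rho> P by auto
        then show ?thesis using x(1) by blast
      qed (use W th in auto)
    qed
    have cardX: "?\<mu> ?B \<le> 1/2 * ?\<mu> ?B + real (card X) * (8 ^ dd * \<mu>0)"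
    proof -
      have Um: "(\<Union>x\<in>X. mbox x 4 \<rho> P) \<in> lmeasurable" using X(1) by (intro fmeasurable.finite_UN) auto
      have "?\<mu> ?B \<le> ?\<mu> (W \<union> (\<Union>x\<in>X. mbox x 4 \<rho> P))"
        by (rule measure_mono_fmeasurable[OF cover fmeasurableD[OF gbox_lmeasurable] fmeasurable.Un[OF W(1) Um]])
      also have "\<dots> \<le> ?\<mu> W + ?\<mu> (\<Union>x\<in>X. mbox x 4 \<rho> P)"
        using W(1) Um by (intro measure_Un_le) (auto dest: fmeasurableD)
      also have "?\<mu> (\<Union>x\<in>X. mbox x 4 \<rho> P) \<le> (\<Sum>x\<in>X. ?\<mu> (mbox x 4 \<rho> P))"
        using X(1) by (intro measure_UNION_le) (auto intro: fmeasurableD)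
      also have "\<dots> = real (card X) * (8 ^ dd * \<mu>0)" by (simp add: mm)
      finally show ?thesis using \<open>?\<mu> W \<le> 1/2 * ?\<mu> ?B\<close> by linarith
    qed
    have pert: "\<exists>\<theta>1. \<theta>1 \<in> mbox \<theta> 1 \<rho> P \<and> good \<delta>' r' R' \<theta>1 \<and>
       (\<exists>p q. (\<forall>j. [p j = vp j] (mod N)) \<and> (\<forall>k. [q k = vq k] (mod N)) \<and>
              (\<forall>\<theta>\<in>mbox \<theta>1 \<sigma>' r' R'. \<forall>j. \<bar>lf \<theta> p q j\<bar> \<le> e * r' j) \<and>
              (\<forall>k. \<bar>real_of_int (q k)\<bar> \<le> e * R' k))" if "\<theta> \<in> X" for \<theta>
    proof -
      have g: "good \<eta> \<rho> P \<theta>" using that X(2) by (auto simp: A_def)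
      obtain \<theta>1 p q where t: "\<theta>1 \<in> mbox \<theta> 1 \<rho> P" "good (\<eta> / 2) \<rho> P \<theta>1"
        and pq: "\<And>j. [p j = vp j] (mod N)" "\<And>k. [q k = vq k] (mod N)"
        and z: "\<And>j. lf \<theta>1 p q j = 0" and q: "\<And>k. \<bar>real_of_int (q k)\<bar> \<le> 3 * of_int N * C * P k"
        using perturb_to_solution[where vp = vp and vq = vq, OF \<rho> P C N g cov[OF allI[OF \<rho>] allI[OF P] volP g]] by blast
      have q': "\<bar>real_of_int (q k)\<bar> \<le> D * P k" for k using q[of k] by (simp add: D_def)
      have "good \<delta>' r' R' \<theta>1"
        unfolding good_def
      proof (intro allI impI)
        fix p' q' assume 1: "\<forall>j. \<bar>lf \<theta>1 p' q' j\<bar> \<le> \<delta>' * r' j" and 2: "\<forall>k. \<bar>real_of_int (q' k)\<bar> \<le> \<delta>' * R' k"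
        have "\<bar>lf \<theta>1 p' q' j\<bar> \<le> \<eta> / 2 * \<rho> j" for j
        proof -
          have "\<delta>' * r' j \<le> \<eta> / 2 * \<rho> j"
            unfolding \<delta>'_def \<rho>_def using \<eta> r'[of j] l h
            by (intro mult_mono) (auto simp: pos_divide_le_eq mult_left_le mult_le_cancel_right1)
          then show ?thesis using 1 by (meson order_trans)
        qed
        moreover have "\<bar>real_of_int (q' k)\<bar> \<le> \<eta> / 2 * P k" for k
          using 2[rule_format, of k] by (simp add: \<delta>'_def P_def)
        ultimately show "p' = (\<lambda>_. 0) \<and> q' = (\<lambda>_. 0)" using t(2) unfolding good_def by blast
      qed
      moreover have "\<bar>lf \<theta>2 p q j\<bar> \<le> e * r' j" if "\<theta>2 \<in> mbox \<theta>1 \<sigma>' r' R'" for \<theta>2 j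
      proof -
        have "\<theta>2 \<in> mbox \<theta>1 \<sigma>2 \<rho> P" using that by (simp only: resc \<sigma>'_def)
        from lf_bound[OF this, of p q j] have "\<bar>lf \<theta>2 p q j\<bar> \<le> (\<Sum>k\<in>UNIV. \<sigma>2 * \<rho> j / P k * \<bar>of_int (q k)\<bar>)"
          by (simp add: z)
        also have "\<dots> \<le> (\<Sum>k\<in>UNIV. \<sigma>2 * \<rho> j / P k * (D * P k))"
          using q' \<sigma>2 \<rho>[of j] P by (intro sum_mono mult_left_mono) (auto simp: less_imp_le)
        also have "\<dots> = (\<Sum>k\<in>(UNIV::'n set). \<sigma>2 * \<rho> j * D)"
        proof (intro sum.cong refl)
          fix k show "\<sigma>2 * \<rho> j / P k * (D * P k) = \<sigma>2 * \<rho> j * D" using P[of k] by simp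
        qed
        also have "\<dots> = nn * \<sigma>2 * D * l * r' j" by (simp add: nn_def \<rho>_def)
        also have "\<dots> \<le> e * r' j" using \<sigma>2e r'[of j] by (intro mult_right_mono) auto
        finally show ?thesis .
      qed
      moreover have "\<bar>real_of_int (q k)\<bar> \<le> e * R' k" for k
      proof -
        have "D * P k = D / h * R' k" by (simp add: P_def)
        also have "\<dots> \<le> e * R' k" using Dh R'[of k] by (intro mult_right_mono) auto
        finally show ?thesis using q'[of k] by linarith
      qed
      ultimately show ?thesis using t(1) pq by blast
    qed
    then obtain G where G: "\<And>\<theta>. \<theta> \<in> X \<Longrightarrow> G \<theta> \<in> mbox \<theta> 1 \<rho> P \<and> good \<delta>' r' R' (G \<theta>) \<and>
       (\<exists>p q. (\<forall>j. [p j = vp j] (mod N)) \<and> (\<forall>k. [q k = vq k] (mod N)) \<and>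
              (\<forall>\<theta>2\<in>mbox (G \<theta>) \<sigma>' r' R'. \<forall>j. \<bar>lf \<theta>2 p q j\<bar> \<le> e * r' j) \<and>
              (\<forall>k. \<bar>real_of_int (q k)\<bar> \<le> e * R' k))"
      by metis
    have Gsub: "mbox (G \<theta>) \<sigma>' r' R' \<subseteq> mbox \<theta> 2 \<rho> P" if "\<theta> \<in> X" for \<theta>
    proof -
      have "mbox (G \<theta>) \<sigma>2 \<rho> P \<subseteq> mbox \<theta> 2 \<rho> P"
        using G[OF that] \<sigma>2 \<rho> P by (intro mbox_mono[of _ _ 1]) auto
      then show ?thesis by (simp only: resc \<sigma>'_def)
    qed
    have Gdis: "disjnt (mbox (G x) \<sigma>' r' R') (mbox (G y) \<sigma>' r' R')" if "x \<in> X" "y \<in> X" "x \<noteq> y" for x y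
      using X(3) Gsub[OF that(1)] Gsub[OF that(2)] that unfolding pairwise_def disjnt_def by blast
    have Gin: "G x \<in> mbox (G x) \<sigma>' r' R'" for x
      using \<sigma>' r' R' by (simp add: gbox_def less_imp_le)
    \<comment> \<open>Disjoint boxes contain their own centres, so the sum over the image of
      \<open>X\<close> has as many terms as \<open>X\<close>.\<close>
    have inj: "inj_on G X"
    proof (rule inj_onI, rule ccontr)
      fix x y assume "x \<in> X" "y \<in> X" "G x = G y" "x \<noteq> y"
      then show False using Gdis[of x y] Gin[of x] by (auto simp: disjnt_def)
    qed
    show ?thesis
    proof (intro exI[of _ "G ` X"] conjI ballI)
      show "finite (G ` X)" using X(1) by simp
      show "pairwise (\<lambda>a b. disjnt (mbox a \<sigma>' r' R') (mbox b \<sigma>' r' R')) (G ` X)"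
        unfolding pairwise_def using Gdis by blast
      have "(\<Sum>\<theta>1\<in>G ` X. ?\<mu> (mbox \<theta>1 \<sigma>' r' R')) = (\<Sum>x\<in>X. ?\<mu> (mbox (G x) \<sigma>2 \<rho> P))"
        using inj by (simp add: sum.reindex resc \<sigma>'_def)
      also have "\<dots> = real (card X) * ((2 * \<sigma>2) ^ dd * \<mu>0)" using \<sigma>2 by (simp add: mm)
      also have "(2 * \<sigma>2) ^ dd = (\<sigma>2 / 4) ^ dd * 8 ^ dd"
        by (subst power_mult_distrib[symmetric]) simp
      finally have s: "(\<Sum>\<theta>1\<in>G ` X. ?\<mu> (mbox \<theta>1 \<sigma>' r' R')) = (\<sigma>2 / 4) ^ dd * (real (card X) * (8 ^ dd * \<mu>0))"
        by (simp only: mult_ac)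
      have "?\<mu> ?B = (1/2) ^ dd * ?\<mu> (mbox \<theta>0 \<sigma> r R)"
      proof -
        define M where "M = (\<Prod>j\<in>UNIV. \<Prod>k\<in>UNIV. r j / R k)"
        have "?\<mu> (mbox \<theta>0 s r R) = (2 * s) ^ dd * M" if "s \<ge> 0" for s
          unfolding dd_def M_def by (rule measure_mbox[OF r R that])
        from this[of "\<sigma> / 2"] this[of \<sigma>]
        have 1: "?\<mu> ?B = (2 * (\<sigma> / 2)) ^ dd * M" "?\<mu> (mbox \<theta>0 \<sigma> r R) = (2 * \<sigma>) ^ dd * M"
          using \<sigma> by (simp_all only: less_imp_le half_gt_zero)
        have "(2 * (\<sigma> / 2)) ^ dd = (1/2) ^ dd * (2 * \<sigma>) ^ dd"
          by (subst power_mult_distrib[symmetric]) simp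
        then show ?thesis unfolding 1 by (simp only: mult.assoc)
      qed
      then have "c * ?\<mu> (mbox \<theta>0 \<sigma> r R) = (\<sigma>2 / 4) ^ dd * (1/2 * ?\<mu> ?B)" by (simp add: c_def)
      also have "\<dots> \<le> (\<sigma>2 / 4) ^ dd * (real (card X) * (8 ^ dd * \<mu>0))"
        using cardX \<sigma>2 by (intro mult_left_mono) auto
      finally show "c * ?\<mu> (mbox \<theta>0 \<sigma> r R) \<le> (\<Sum>\<theta>1\<in>G ` X. ?\<mu> (mbox \<theta>1 \<sigma>' r' R'))" unfolding s .
    next
      fix \<theta>1 assume "\<theta>1 \<in> G ` X"
      then obtain x where x: "x \<in> X" "\<theta>1 = G x" by blast
      show "good \<delta>' r' R' \<theta>1" "\<exists>p q. (\<forall>j. [p j = vp j] (mod N)) \<and> (\<forall>k. [q k = vq k] (mod N)) \<and>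
              (\<forall>\<theta>\<in>mbox \<theta>1 \<sigma>' r' R'. \<forall>j. \<bar>lf \<theta> p q j\<bar> \<le> e * r' j) \<and>
              (\<forall>k. \<bar>real_of_int (q k)\<bar> \<le> e * R' k)"
        using G[OF x(1)] x(2) by blast+
      have "x \<in> ?B" using x(1) X(2) by (auto simp: A_def)
      then show "mbox \<theta>1 \<sigma>' r' R' \<subseteq> mbox \<theta>0 \<sigma> r R" using Gsub[OF x(1)] sub2 x(2) by blast
    qed
  qed
  show ?thesis
    by (rule exI[of _ \<tau>], rule conjI[OF \<tau>], rule exI[of _ \<sigma>'], rule conjI[OF \<sigma>'],
        rule exI[of _ \<delta>'], rule conjI[OF \<delta>'], rule exI[of _ c], rule conjI[OF c],
        rule conjI[OF \<sigma>'n[unfolded nn_def]], intro allI impI, rule main) simp_all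
qed

section \<open>Sets of upper density less than one\<close>

lemma open_superset_measure_le:
  assumes "T \<in> lmeasurable" "\<epsilon> > 0"
  obtains O' where "open O'" "T \<subseteq> O'" "O' \<in> lmeasurable" "measure lebesgue O' \<le> measure lebesgue T + \<epsilon>"
proof -
  obtain O' where O': "open O'" "T \<subseteq> O'" "O' - T \<in> lmeasurable" "emeasure lebesgue (O' - T) < ennreal \<epsilon>"
    using sets_lebesgue_outer_open[OF fmeasurableD[OF assms(1)] assms(2)] by metis
  have eq: "O' = T \<union> (O' - T)" using O'(2) by blast
  have "measure lebesgue (O' - T) \<le> \<epsilon>"
    using O'(3,4) assms(2) by (simp add: emeasure_eq_measure2 ennreal_less_iff less_imp_le)
  moreover have "measure lebesgue O' \<le> measure lebesgue T + measure lebesgue (O' - T)"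
    using measure_Un_le[OF fmeasurableD[OF assms(1)] fmeasurableD[OF O'(3)]] eq by simp
  moreover have "O' \<in> lmeasurable" using fmeasurable.Un[OF assms(1) O'(3)] eq by simp
  ultimately show ?thesis using that[OF O'(1,2)] by simp
qed

text \<open>Vitali covers the set, up to a null set, by disjoint balls inside a given open superset,
  and each ball loses a proportion \<open>c\<close> to its hole. So the outer measure shrinks by a
  fixed factor, and iteration sends it to 0. Measurable supersets replace \<open>S\<close>
  throughout because \<open>S\<close> may be non-measurable.\<close>

lemma negligible_upper_density_lt_1:
  fixes S :: "'a::euclidean_space set"
  assumes c: "0 < c" "c \<le> 1"
    and dens: "\<And>x \<epsilon>. x \<in> S \<Longrightarrow> \<epsilon> > 0 \<Longrightarrow> \<exists>d U. 0 < d \<and> d < \<epsilon> \<and> U \<in> lmeasurable \<and> U \<subseteq> ball x d \<and> S \<inter> U = {}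
       \<and> c * measure lebesgue (ball x d) \<le> measure lebesgue U"
  shows "negligible S"
proof -
  let ?\<mu> = "measure lebesgue"
  have "negligible (S \<inter> ball z 1)" for z
  proof -
    let ?S = "S \<inter> ball z 1"
    have step: "\<exists>T. T \<in> lmeasurable \<and> ?S \<subseteq> T \<and> ?\<mu> T \<le> (1 - c) * ?\<mu> O'"
      if O': "open O'" "O' \<in> lmeasurable" "?S \<subseteq> O'" for O'
    proof -
      define K where "K = {(x,d). 0 < d \<and> ball x d \<subseteq> O' \<and> (\<exists>U. U \<in> lmeasurable \<and> U \<subseteq> ball x d \<and> S \<inter> U = {}
         \<and> c * ?\<mu> (ball x d) \<le> ?\<mu> U)}"
      have cov: "\<exists>i. i \<in> K \<and> x \<in> ball (fst i) (snd i) \<and> snd i < d" if x: "x \<in> ?S" "d > 0" for x d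
      proof -
        obtain k where k: "k > 0" "ball x k \<subseteq> O'" using O' x by (meson openE subsetD)
        obtain d' U where d': "0 < d'" "d' < min d k" "U \<in> lmeasurable" "U \<subseteq> ball x d'" "S \<inter> U = {}"
          "c * ?\<mu> (ball x d') \<le> ?\<mu> U" using dens[of x "min d k"] x k by auto
        have "ball x d' \<subseteq> O'" using k(2) d'(2) by (meson less_imp_le min.strict_boundedE order_trans subset_ball)
        then show ?thesis using d' by (intro exI[of _ "(x,d')"]) (auto simp: K_def)
      qed
      obtain C where C: "countable C" "C \<subseteq> K"
        "pairwise (\<lambda>i j. disjnt (ball (fst i) (snd i)) (ball (fst j) (snd j))) C"
        "negligible (?S - (\<Union>i\<in>C. ball (fst i) (snd i)))"
        by (rule Vitali_covering_theorem_balls[of ?S K fst snd, OF cov])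
      have "\<exists>U. U \<in> lmeasurable \<and> U \<subseteq> ball (fst i) (snd i) \<and> S \<inter> U = {} \<and> c * ?\<mu> (ball (fst i) (snd i)) \<le> ?\<mu> U"
        if "i \<in> C" for i
        using that C(2) unfolding K_def by (cases i) (simp, blast)
      then obtain U where U: "\<And>i. i \<in> C \<Longrightarrow> U i \<in> lmeasurable \<and> U i \<subseteq> ball (fst i) (snd i) \<and> S \<inter> U i = {} \<and> c * ?\<mu> (ball (fst i) (snd i)) \<le> ?\<mu> (U i)"
        by metis
      define V where "V i = ball (fst i) (snd i) - U i" for i
      have Vm: "V i \<in> lmeasurable" if "i \<in> C" for i using U[OF that] by (auto simp: V_def intro: fmeasurable.Diff)
      have Vle: "?\<mu> (V i) \<le> (1 - c) * ?\<mu> (ball (fst i) (snd i))" if "i \<in> C" for i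
      proof -
        have "?\<mu> (V i) = ?\<mu> (ball (fst i) (snd i)) - ?\<mu> (U i)"
          unfolding V_def using U[OF that] by (intro measurable_measure_Diff) (auto dest: fmeasurableD)
        then show ?thesis using U[OF that] by (simp add: algebra_simps)
      qed
      \<comment> \<open>The bound is proved for finite subfamilies, which suffices for the countable
        union by monotone approximation.\<close>
      have bnd: "?\<mu> (\<Union>i\<in>I. V i) \<le> (1 - c) * ?\<mu> O'" if I: "I \<subseteq> C" "finite I" for I
      proof -
        have "?\<mu> (\<Union>i\<in>I. V i) \<le> (\<Sum>i\<in>I. ?\<mu> (V i))"
          using I Vm by (intro measure_UNION_le) (auto intro: fmeasurableD)
        also have "\<dots> \<le> (\<Sum>i\<in>I. (1 - c) * ?\<mu> (ball (fst i) (snd i)))"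
          using I Vle by (intro sum_mono) auto
        also have "\<dots> = (1 - c) * (\<Sum>i\<in>I. ?\<mu> (ball (fst i) (snd i)))" by (simp add: sum_distrib_left)
        also have "(\<Sum>i\<in>I. ?\<mu> (ball (fst i) (snd i))) = ?\<mu> (\<Union>i\<in>I. ball (fst i) (snd i))"
          using I C(3) by (intro measure_UNION'[symmetric]) (auto elim: pairwise_mono)
        also have "(1 - c) * ?\<mu> (\<Union>i\<in>I. ball (fst i) (snd i)) \<le> (1 - c) * ?\<mu> O'"
        proof (intro mult_left_mono measure_mono_fmeasurable O'(2))
          show "(\<Union>i\<in>I. ball (fst i) (snd i)) \<subseteq> O'" using I C(2) by (force simp: K_def)
          show "(\<Union>i\<in>I. ball (fst i) (snd i)) \<in> sets lebesgue" using I by (intro sets.finite_UN) auto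
        qed (use c in auto)
        finally show ?thesis .
      qed
      have UV: "(\<Union>i\<in>C. V i) \<in> lmeasurable" "?\<mu> (\<Union>i\<in>C. V i) \<le> (1 - c) * ?\<mu> O'"
        using fmeasurable_UN_bound[OF C(1) Vm bnd] measure_UN_bound[OF C(1) Vm bnd] by blast+
      let ?N = "?S - (\<Union>i\<in>C. ball (fst i) (snd i))"
      have N: "?N \<in> lmeasurable" "?\<mu> ?N = 0"
        using C(4) negligible_imp_measurable negligible_imp_measure0 by auto
      have "?S \<subseteq> ?N \<union> (\<Union>i\<in>C. V i)" using U unfolding V_def by blast
      moreover have "?\<mu> (?N \<union> (\<Union>i\<in>C. V i)) \<le> (1 - c) * ?\<mu> O'"
        using measure_Un_le[OF fmeasurableD[OF N(1)] fmeasurableD[OF UV(1)]] N(2) UV(2) by linarith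
      ultimately show ?thesis using fmeasurable.Un[OF N(1) UV(1)] by blast
    qed
    define M where "M = ?\<mu> (ball z 1)"
    have M: "M > 0" by (simp add: M_def content_ball_pos)
    \<comment> \<open>Half of the gain \<open>c\<close> is spent on enlarging the superset
      \<open>T\<close> to an open set again.\<close>
    define g where "g = 1 - c / 2"
    have g: "0 < g" "g < 1" using c by (auto simp: g_def)
    have iter: "\<exists>O'. open O' \<and> O' \<in> lmeasurable \<and> ?S \<subseteq> O' \<and> ?\<mu> O' \<le> g ^ n * M" for n
    proof (induction n)
      case 0
      show ?case by (intro exI[of _ "ball z 1"]) (auto simp: M_def)
    next
      case (Suc n)
      then obtain O' where O': "open O'" "O' \<in> lmeasurable" "?S \<subseteq> O'" "?\<mu> O' \<le> g ^ n * M" by blast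
      obtain T where T: "T \<in> lmeasurable" "?S \<subseteq> T" "?\<mu> T \<le> (1 - c) * ?\<mu> O'" using step[OF O'(1-3)] by blast
      have gM: "g ^ n * M > 0" using g M by simp
      obtain O2 where O2: "open O2" "T \<subseteq> O2" "O2 \<in> lmeasurable" "?\<mu> O2 \<le> ?\<mu> T + c / 2 * (g ^ n * M)"
        using open_superset_measure_le[OF T(1), of "c / 2 * (g ^ n * M)"] c gM by auto
      have "(1 - c) * ?\<mu> O' \<le> (1 - c) * (g ^ n * M)" using O'(4) c by (intro mult_left_mono) auto
      then have "?\<mu> O2 \<le> (1 - c) * (g ^ n * M) + c / 2 * (g ^ n * M)" using O2(4) T(3) by linarith
      also have "\<dots> = g ^ Suc n * M" by (simp add: g_def algebra_simps)
      finally show ?case using O2 T(2) by blast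
    qed
    show ?thesis
      unfolding negligible_outer_le
    proof (intro allI impI)
      fix e :: real assume "e > 0"
      then obtain n where "g ^ n < e / M" using real_arch_pow_inv[of "e / M" g] g M by auto
      then have "g ^ n * M \<le> e" using M by (simp add: field_simps)
      with iter[of n] show "\<exists>T. ?S \<subseteq> T \<and> T \<in> lmeasurable \<and> ?\<mu> T \<le> e" by (meson order_trans)
    qed
  qed
  then show ?thesis
    unfolding locally_negligible_alt[of S]
    by (metis IntI centre_in_ball openin_open_Int open_ball zero_less_one)
qed

section \<open>Iterating over the levels\<close>

text \<open>Strict inequality of exponents outgrows any constant; this yields the scale separation
  \<open>\<tau>\<close> required by \<open>refine_good_box\<close>.\<close>

lemma eventually_powr_le:
  assumes "a < b" "\<tau> > 0"
  shows "\<forall>\<^sub>F Q::real in at_top. Q powr a \<le> \<tau> * Q powr b"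
proof -
  have "((\<lambda>Q::real. Q powr (a - b)) \<longlongrightarrow> 0) at_top"
    using assms(1) by (intro tendsto_neg_powr filterlim_ident) auto
  then have "\<forall>\<^sub>F Q::real in at_top. Q powr (a - b) < \<tau>" using assms(2) by (rule order_tendstoD)
  then show ?thesis using eventually_gt_at_top[of 0]
  proof eventually_elim
    case (elim Q)
    have "Q powr a = Q powr (a - b) * Q powr b" by (simp flip: powr_add)
    then show ?case using elim by (simp add: mult_right_mono less_imp_le)
  qed
qed

text \<open>One modulus \<open>N\<close> serves all coordinates and \<open>e\<close> multiplies each
  coordinate bound. The separate moduli and the quasi-norms are recovered in the final
  theorem.\<close>

definition hits :: "int \<Rightarrow> ('m::finite \<Rightarrow> int) \<Rightarrow> ('n::finite \<Rightarrow> int) \<Rightarrow> real \<Rightarrow> ('m \<Rightarrow> real) \<Rightarrow> ('n \<Rightarrow> real) \<Rightarrow> (real^'n^'m) set"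
  where "hits N vp vq e r R = {\<theta>. \<exists>p q. (\<forall>j. [p j = vp j] (mod N)) \<and> (\<forall>k. [q k = vq k] (mod N)) \<and>
     (\<forall>j. \<bar>lf \<theta> p q j\<bar> \<le> e * r j) \<and> (\<forall>k. \<bar>real_of_int (q k)\<bar> \<le> e * R k)}"

abbreviation (input) rad :: "('m \<Rightarrow> real) \<Rightarrow> real \<Rightarrow> 'm \<Rightarrow> real" where "rad a Q \<equiv> (\<lambda>j. Q powr (- a j))"
abbreviation (input) siz :: "('n \<Rightarrow> real) \<Rightarrow> real \<Rightarrow> 'n \<Rightarrow> real" where "siz b Q \<equiv> (\<lambda>k. Q powr b k)"

lemma vol_powr:
  fixes a :: "'m::finite \<Rightarrow> real" and b :: "'n::finite \<Rightarrow> real"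
  assumes "Q > 0" "(\<Sum>j\<in>UNIV. a j) = (\<Sum>k\<in>UNIV. b k)"
  shows "(\<Prod>j\<in>UNIV. rad a Q j) * (\<Prod>k\<in>UNIV. siz b Q k) = 1"
proof -
  have "(\<Prod>j\<in>UNIV. rad a Q j) * (\<Prod>k\<in>UNIV. siz b Q k) = Q powr (\<Sum>j\<in>UNIV. - a j) * Q powr (\<Sum>k\<in>UNIV. b k)"
    using assms(1) by (simp add: powr_sum)
  then show ?thesis using assms by (simp add: sum_negf flip: powr_add)
qed

text \<open>Downward induction on the level: \<open>refine_good_box\<close> produces disjoint boxes
  that solve level \<open>i + 1\<close> and have good centres, and the induction hypothesis is
  applied inside each of them. The proportions multiply, uniformly in \<open>Q\<close> and the
  centre. Level \<open>i\<close> is needed only as a source of goodness, hence the range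
  \<open>{i<..L}\<close>.\<close>

lemma positive_proportion_hits:
  fixes a :: "nat \<Rightarrow> 'm::finite \<Rightarrow> real" and b :: "nat \<Rightarrow> 'n::finite \<Rightarrow> real" and vp vq
  assumes N: "N \<ge> 1" and e: "e > 0"
    and sums: "\<And>i. i \<le> L \<Longrightarrow> (\<Sum>j\<in>UNIV. a i j) = (\<Sum>k\<in>UNIV. b i k)"
    and inca: "\<And>i j. i < L \<Longrightarrow> a i j < a (Suc i) j" and incb: "\<And>i k. i < L \<Longrightarrow> b i k < b (Suc i) k"
    and i: "i \<le> L" and \<sigma>: "\<sigma> > 0" "real CARD('n) * \<sigma> \<le> 1/2" and \<delta>: "\<delta> > 0"
  shows "\<exists>c>0. \<forall>\<^sub>F Q in at_top. \<forall>\<theta>0::real^'n^'m. good \<delta> (rad (a i) Q) (siz (b i) Q) \<theta>0 \<longrightarrow>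
     (\<exists>U\<in>lmeasurable. U \<subseteq> mbox \<theta>0 \<sigma> (rad (a i) Q) (siz (b i) Q) \<and>
        (\<forall>l\<in>{i<..L}. U \<subseteq> hits N (vp l) (vq l) e (rad (a l) Q) (siz (b l) Q)) \<and>
        c * measure lebesgue (mbox \<theta>0 \<sigma> (rad (a i) Q) (siz (b i) Q)) \<le> measure lebesgue U)"
  using i \<sigma> \<delta>
proof (induction arbitrary: \<sigma> \<delta> rule: inc_induct)
  case base
  \<comment> \<open>At level \<open>L\<close> no system remains to be solved, so \<open>U\<close> is
    the whole box and the proportion is 1.\<close>
  show ?case
    by (intro exI[of _ 1] conjI always_eventually allI impI) (auto intro!: bexI[OF _ gbox_lmeasurable])
next
  case (step i)
  obtain \<tau> \<sigma>' \<delta>' c1 where pos: "\<tau> > 0" "\<sigma>' > 0" "\<delta>' > 0" "c1 > 0" "real CARD('n) * \<sigma>' \<le> 1/2"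
    and X: "\<forall>r R r' R' (\<theta>0::real^'n^'m).
       (\<forall>j. r j > 0 \<and> r' j > 0 \<and> r' j \<le> \<tau> * r j) \<longrightarrow> (\<forall>k. R k > 0 \<and> R' k > 0 \<and> R k \<le> \<tau> * R' k) \<longrightarrow>
       (\<Prod>j\<in>UNIV. r j) * (\<Prod>k\<in>UNIV. R k) = 1 \<longrightarrow> (\<Prod>j\<in>UNIV. r' j) * (\<Prod>k\<in>UNIV. R' k) = 1 \<longrightarrow>
       good \<delta> r R \<theta>0 \<longrightarrow>
       (\<exists>X. finite X \<and> pairwise (\<lambda>a b. disjnt (mbox a \<sigma>' r' R') (mbox b \<sigma>' r' R')) X \<and>
         c1 * measure lebesgue (mbox \<theta>0 \<sigma> r R) \<le> (\<Sum>\<theta>1\<in>X. measure lebesgue (mbox \<theta>1 \<sigma>' r' R')) \<and>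
         (\<forall>\<theta>1\<in>X. good \<delta>' r' R' \<theta>1 \<and> mbox \<theta>1 \<sigma>' r' R' \<subseteq> mbox \<theta>0 \<sigma> r R \<and>
           (\<exists>p q. (\<forall>j. [p j = vp (Suc i) j] (mod N)) \<and> (\<forall>k. [q k = vq (Suc i) k] (mod N)) \<and>
              (\<forall>\<theta>\<in>mbox \<theta>1 \<sigma>' r' R'. \<forall>j. \<bar>lf \<theta> p q j\<bar> \<le> e * r' j) \<and>
              (\<forall>k. \<bar>real_of_int (q k)\<bar> \<le> e * R' k))))"
    using refine_good_box[OF step.prems(1,2,3) e N, of "vp (Suc i)" "vq (Suc i)"] by (elim exE conjE) (rule that)
  obtain c2 where c2: "c2 > 0" and ev: "\<forall>\<^sub>F Q in at_top. \<forall>\<theta>0::real^'n^'m. good \<delta>' (rad (a (Suc i)) Q) (siz (b (Suc i)) Q) \<theta>0 \<longrightarrow>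
     (\<exists>U\<in>lmeasurable. U \<subseteq> mbox \<theta>0 \<sigma>' (rad (a (Suc i)) Q) (siz (b (Suc i)) Q) \<and>
        (\<forall>l\<in>{Suc i<..L}. U \<subseteq> hits N (vp l) (vq l) e (rad (a l) Q) (siz (b l) Q)) \<and>
        c2 * measure lebesgue (mbox \<theta>0 \<sigma>' (rad (a (Suc i)) Q) (siz (b (Suc i)) Q)) \<le> measure lebesgue U)"
    using step.IH[OF pos(2,5,3)] by blast
  have e1: "\<forall>\<^sub>F Q in at_top. \<forall>j. rad (a (Suc i)) Q j \<le> \<tau> * rad (a i) Q j"
    using inca[OF step.hyps(2)] pos by (intro eventually_all_finite eventually_powr_le) auto
  have e2: "\<forall>\<^sub>F Q in at_top. \<forall>k. siz (b i) Q k \<le> \<tau> * siz (b (Suc i)) Q k"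
    using incb[OF step.hyps(2)] pos by (intro eventually_all_finite eventually_powr_le) auto
  show ?case
  proof (rule exI[of _ "c1 * c2"], rule conjI)
    show "c1 * c2 > 0" using pos c2 by simp
    show "\<forall>\<^sub>F Q in at_top. \<forall>\<theta>0::real^'n^'m. good \<delta> (rad (a i) Q) (siz (b i) Q) \<theta>0 \<longrightarrow>
     (\<exists>U\<in>lmeasurable. U \<subseteq> mbox \<theta>0 \<sigma> (rad (a i) Q) (siz (b i) Q) \<and>
        (\<forall>l\<in>{i<..L}. U \<subseteq> hits N (vp l) (vq l) e (rad (a l) Q) (siz (b l) Q)) \<and>
        c1 * c2 * measure lebesgue (mbox \<theta>0 \<sigma> (rad (a i) Q) (siz (b i) Q)) \<le> measure lebesgue U)"
      using e1 e2 ev eventually_gt_at_top[of 0]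
    proof eventually_elim
      case (elim Q)
      show ?case
      proof (intro allI impI)
        fix \<theta>0 :: "real^'n^'m" assume gd: "good \<delta> (rad (a i) Q) (siz (b i) Q) \<theta>0"
        let ?r = "rad (a i) Q" and ?R = "siz (b i) Q" and ?r' = "rad (a (Suc i)) Q" and ?R' = "siz (b (Suc i)) Q"
        let ?\<mu> = "measure lebesgue"
        have p1: "\<forall>j. ?r j > 0 \<and> ?r' j > 0 \<and> ?r' j \<le> \<tau> * ?r j" using elim by simp
        have p2: "\<forall>k. ?R k > 0 \<and> ?R' k > 0 \<and> ?R k \<le> \<tau> * ?R' k" using elim by simp
        have v1: "(\<Prod>j\<in>UNIV. ?r j) * (\<Prod>k\<in>UNIV. ?R k) = 1"
          using elim step.hyps by (intro vol_powr sums) auto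
        have v2: "(\<Prod>j\<in>UNIV. ?r' j) * (\<Prod>k\<in>UNIV. ?R' k) = 1"
          using elim step.hyps by (intro vol_powr sums) auto
        obtain Y where Y: "finite Y" "pairwise (\<lambda>a b. disjnt (mbox a \<sigma>' ?r' ?R') (mbox b \<sigma>' ?r' ?R')) Y"
         "c1 * ?\<mu> (mbox \<theta>0 \<sigma> ?r ?R) \<le> (\<Sum>\<theta>1\<in>Y. ?\<mu> (mbox \<theta>1 \<sigma>' ?r' ?R'))"
         and Y2: "\<forall>\<theta>1\<in>Y. good \<delta>' ?r' ?R' \<theta>1 \<and> mbox \<theta>1 \<sigma>' ?r' ?R' \<subseteq> mbox \<theta>0 \<sigma> ?r ?R \<and>
           (\<exists>p q. (\<forall>j. [p j = vp (Suc i) j] (mod N)) \<and> (\<forall>k. [q k = vq (Suc i) k] (mod N)) \<and>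
              (\<forall>\<theta>\<in>mbox \<theta>1 \<sigma>' ?r' ?R'. \<forall>j. \<bar>lf \<theta> p q j\<bar> \<le> e * ?r' j) \<and>
              (\<forall>k. \<bar>real_of_int (q k)\<bar> \<le> e * ?R' k))"
          using X[THEN spec[of _ ?r], THEN spec[of _ ?R], THEN spec[of _ ?r'], THEN spec[of _ ?R'], THEN spec[of _ \<theta>0],
              THEN mp[OF _ p1], THEN mp[OF _ p2], THEN mp[OF _ v1], THEN mp[OF _ v2], THEN mp[OF _ gd]]
          by (elim exE conjE) (rule that)
        have "\<exists>U. U \<in> lmeasurable \<and> U \<subseteq> mbox \<theta>1 \<sigma>' ?r' ?R' \<and>
          (\<forall>l\<in>{Suc i<..L}. U \<subseteq> hits N (vp l) (vq l) e (rad (a l) Q) (siz (b l) Q)) \<and>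
          c2 * ?\<mu> (mbox \<theta>1 \<sigma>' ?r' ?R') \<le> ?\<mu> U" if "\<theta>1 \<in> Y" for \<theta>1
          using elim(3)[THEN spec[of _ \<theta>1], THEN mp[OF _ conjunct1[OF bspec[OF Y2 that]]]] unfolding Bex_def .
        then obtain U where U: "\<And>\<theta>1. \<theta>1 \<in> Y \<Longrightarrow> U \<theta>1 \<in> lmeasurable \<and> U \<theta>1 \<subseteq> mbox \<theta>1 \<sigma>' ?r' ?R' \<and>
          (\<forall>l\<in>{Suc i<..L}. U \<theta>1 \<subseteq> hits N (vp l) (vq l) e (rad (a l) Q) (siz (b l) Q)) \<and>
          c2 * ?\<mu> (mbox \<theta>1 \<sigma>' ?r' ?R') \<le> ?\<mu> (U \<theta>1)" by metis
        have Um: "U \<theta>1 \<in> lmeasurable" and Usub: "U \<theta>1 \<subseteq> mbox \<theta>1 \<sigma>' ?r' ?R'"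
          and Uhit: "\<And>l. l \<in> {Suc i<..L} \<Longrightarrow> U \<theta>1 \<subseteq> hits N (vp l) (vq l) e (rad (a l) Q) (siz (b l) Q)"
          and Ule: "c2 * ?\<mu> (mbox \<theta>1 \<sigma>' ?r' ?R') \<le> ?\<mu> (U \<theta>1)" if "\<theta>1 \<in> Y" for \<theta>1
          using U[OF that] by auto
        have Ysub: "mbox \<theta>1 \<sigma>' ?r' ?R' \<subseteq> mbox \<theta>0 \<sigma> ?r ?R" if "\<theta>1 \<in> Y" for \<theta>1
          using bspec[OF Y2 that] by (elim conjE)
        have hit: "mbox \<theta>1 \<sigma>' ?r' ?R' \<subseteq> hits N (vp (Suc i)) (vq (Suc i)) e ?r' ?R'" if "\<theta>1 \<in> Y" for \<theta>1
          using bspec[OF Y2 that] unfolding hits_def by blast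
        show "\<exists>U\<in>lmeasurable. U \<subseteq> mbox \<theta>0 \<sigma> ?r ?R \<and>
            (\<forall>l\<in>{i<..L}. U \<subseteq> hits N (vp l) (vq l) e (rad (a l) Q) (siz (b l) Q)) \<and>
            c1 * c2 * ?\<mu> (mbox \<theta>0 \<sigma> ?r ?R) \<le> ?\<mu> U"
        proof (rule bexI[of _ "\<Union>\<theta>1\<in>Y. U \<theta>1"], intro conjI ballI)
          show "(\<Union>\<theta>1\<in>Y. U \<theta>1) \<in> lmeasurable" using Y(1) Um by (intro fmeasurable.finite_UN) auto
          show "(\<Union>\<theta>1\<in>Y. U \<theta>1) \<subseteq> mbox \<theta>0 \<sigma> ?r ?R"
            using Usub Ysub by (meson UN_least order_trans)
          show "(\<Union>\<theta>1\<in>Y. U \<theta>1) \<subseteq> hits N (vp l) (vq l) e (rad (a l) Q) (siz (b l) Q)" if l: "l \<in> {i<..L}" for l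
          proof (cases "l = Suc i")
            case True
            then show ?thesis using Usub hit by (simp only:) (meson UN_least order_trans)
          next
            case False
            then have "l \<in> {Suc i<..L}" using l by auto
            then show ?thesis using Uhit by (meson UN_least)
          qed
          have dis: "pairwise (\<lambda>a b. disjnt (U a) (U b)) Y"
            using Y(2) Usub unfolding pairwise_def by (meson disjnt_subset1 disjnt_subset2)
          have "c1 * c2 * ?\<mu> (mbox \<theta>0 \<sigma> ?r ?R) = c2 * (c1 * ?\<mu> (mbox \<theta>0 \<sigma> ?r ?R))" by simp
          also have "\<dots> \<le> c2 * (\<Sum>\<theta>1\<in>Y. ?\<mu> (mbox \<theta>1 \<sigma>' ?r' ?R'))" using Y(3) c2 by (intro mult_left_mono) auto
          also have "\<dots> \<le> (\<Sum>\<theta>1\<in>Y. ?\<mu> (U \<theta>1))" unfolding sum_distrib_left by (intro sum_mono Ule)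
          also have "\<dots> = ?\<mu> (\<Union>\<theta>1\<in>Y. U \<theta>1)"
            using Y(1) Um dis by (intro measure_UNION'[symmetric])
          finally show "c1 * c2 * ?\<mu> (mbox \<theta>0 \<sigma> ?r ?R) \<le> ?\<mu> (\<Union>\<theta>1\<in>Y. U \<theta>1)" .
        qed
      qed
    qed
  qed
qed

section \<open>Frequently good matrices\<close>

lemma norm_matrix_le: "norm (M :: real^'n^'m) \<le> (\<Sum>j\<in>UNIV. \<Sum>k\<in>UNIV. \<bar>M$j$k\<bar>)"
proof -
  have "norm M \<le> (\<Sum>j\<in>UNIV. norm (M$j))"
    unfolding norm_vec_def by (rule L2_set_le_sum) simp
  also have "\<dots> \<le> (\<Sum>j\<in>UNIV. \<Sum>k\<in>UNIV. \<bar>M$j$k\<bar>)" by (intro sum_mono norm_le_l1_cart)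
  finally show ?thesis .
qed

lemma ball_subset_gbox: "ball x d \<subseteq> gbox x (\<lambda>_ _. d)"
proof
  fix \<theta> assume "\<theta> \<in> ball x d"
  then have n: "norm (\<theta> - x) < d" by (simp add: dist_norm norm_minus_commute)
  have "\<bar>\<theta>$j$k - x$j$k\<bar> \<le> d" for j k
  proof -
    have "\<bar>(\<theta> - x)$j$k\<bar> \<le> norm ((\<theta> - x)$j)" by (rule component_le_norm_cart)
    also have "\<dots> \<le> norm (\<theta> - x)" by (rule Finite_Cartesian_Product.norm_nth_le)
    finally show ?thesis using n by simp
  qed
  then show "\<theta> \<in> gbox x (\<lambda>_ _. d)" by (simp add: gbox_def)
qed

text \<open>The factor 2 makes the inclusion in the open ball strict.\<close>

lemma gbox_subset_ball:
  fixes x :: "real^'n^'m"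
  assumes "s > 0"
  shows "gbox x (\<lambda>_ _. s) \<subseteq> ball x (2 * real CARD('m) * real CARD('n) * s)"
proof
  fix \<theta> assume \<theta>: "\<theta> \<in> gbox x (\<lambda>_ _. s)"
  have "norm (\<theta> - x) \<le> (\<Sum>j\<in>UNIV. \<Sum>k\<in>UNIV. \<bar>(\<theta> - x)$j$k\<bar>)" by (rule norm_matrix_le)
  also have "\<dots> \<le> (\<Sum>j\<in>(UNIV::'m set). \<Sum>k\<in>(UNIV::'n set). s)"
    using \<theta> by (intro sum_mono) (simp add: gbox_def)
  also have "\<dots> = real CARD('m) * real CARD('n) * s" by simp
  also have "\<dots> < 2 * real CARD('m) * real CARD('n) * s" using assms by simp
  finally show "\<theta> \<in> ball x (2 * real CARD('m) * real CARD('n) * s)"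
    by (simp add: dist_norm norm_minus_commute)
qed

text \<open>Integers of absolute value at most 1/2 vanish: first \<open>q\<close>, then
  \<open>p\<close>. This is the starting level for the first moment estimate on a fixed box.\<close>

lemma good_unscaled: "good (1/2) (\<lambda>_. 1) (\<lambda>_. 1) \<theta>"
  unfolding good_def
proof (intro allI impI)
  fix p q assume p: "\<forall>j. \<bar>lf \<theta> p q j\<bar> \<le> 1/2 * 1" and q: "\<forall>k. \<bar>real_of_int (q k)\<bar> \<le> 1/2 * 1"
  have q0: "q k = 0" for k using q[rule_format, of k] by linarith
  have "p j = 0" for j using p[rule_format, of j] by (simp add: lf_def q0)
  then show "p = (\<lambda>_. 0) \<and> q = (\<lambda>_. 0)" using q0 by auto
qed

text \<open>Comparing the unit scale with time \<open>t\<close> shows that the matrices that are not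
  \<eta>-good at time \<open>t\<close> occupy little of a fixed box, uniformly for large
  \<open>t\<close>. The set of those that fail at all late times is an increasing union of
  intersections and obeys the same bound, which tends to 0 with \<eta>.\<close>

lemma negligible_never_good:
  fixes a :: "'m::finite \<Rightarrow> real" and b :: "'n::finite \<Rightarrow> real"
  assumes a: "\<And>j. a j > 0" and b: "\<And>k. b k > 0" and sums: "(\<Sum>j\<in>UNIV. a j) = (\<Sum>k\<in>UNIV. b k)"
  shows "negligible {\<theta>::real^'n^'m. \<forall>\<eta>>0. \<forall>\<^sub>F t in sequentially. \<not> good \<eta> (rad a (real t)) (siz b (real t)) \<theta>}"
    (is "negligible ?S")
proof -
  let ?\<mu> = "measure lebesgue"
  define \<sigma> where "\<sigma> = 1 / (2 * real CARD('n))"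
  have \<sigma>: "\<sigma> > 0" "real CARD('n) * \<sigma> \<le> 1/2" by (auto simp: \<sigma>_def)
  have "negligible (?S \<inter> ball z \<sigma>)" for z
    unfolding negligible_outer_le
  proof (intro allI impI)
    fix e :: real assume e: "e > 0"
    let ?P = "mbox z \<sigma> (\<lambda>_. 1) (\<lambda>_. 1)"
    define K where "K = 3 * real CARD('n) * (54 / (\<sigma> * (1/2))) ^ CARD('m) * (3 / (1/2)) ^ CARD('n) * (?\<mu> ?P + 1)"
    have P0: "?\<mu> ?P \<ge> 0" by simp
    have "?\<mu> ?P + 1 > 0" using P0 by linarith
    then have K: "K > 0" unfolding K_def using \<sigma> by (intro mult_pos_pos) auto
    \<comment> \<open>The first moment bound contains \<open>\<eta>\<close> to the power
      \<open>CARD('m) + CARD('n)\<close>; since \<open>\<eta> \<le> 1\<close>, one factor of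
      \<open>\<eta>\<close> already brings it below \<open>e\<close>.\<close>
    define \<eta> where "\<eta> = min 1 (e / K)"
    have \<eta>: "\<eta> > 0" "\<eta> \<le> 1" "\<eta> * K \<le> e"
    proof -
      have "\<eta> \<le> e / K" by (simp add: \<eta>_def)
      then show "\<eta> * K \<le> e" using K by (simp add: pos_le_divide_eq)
    qed (use e K in \<open>auto simp: \<eta>_def\<close>)
    have size: "3 * real CARD('n) * (54 * \<eta> / (\<sigma> * (1/2))) ^ CARD('m) * (3 * \<eta> / (1/2)) ^ CARD('n) * ?\<mu> ?P \<le> e"
    proof -
      define k where "k = 3 * real CARD('n) * (54 / (\<sigma> * (1/2))) ^ CARD('m) * (3 / (1/2)) ^ CARD('n)"
      have k: "k \<ge> 0" unfolding k_def using \<sigma> by simp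
      have "3 * real CARD('n) * (54 * \<eta> / (\<sigma> * (1/2))) ^ CARD('m) * (3 * \<eta> / (1/2)) ^ CARD('n) * ?\<mu> ?P
          = k * (\<eta> ^ CARD('m) * \<eta> ^ CARD('n)) * ?\<mu> ?P"
        unfolding k_def by (simp add: power_mult_distrib power_divide)
      also have "\<dots> \<le> k * (\<eta> * 1) * ?\<mu> ?P"
      proof (intro mult_right_mono mult_left_mono mult_mono P0 k)
        have "\<eta> ^ CARD('m) \<le> \<eta> ^ 1" using \<eta> by (intro power_decreasing) (auto simp: Suc_le_eq)
        then show "\<eta> ^ CARD('m) \<le> \<eta>" by simp
        show "\<eta> ^ CARD('n) \<le> 1" using \<eta> by (intro power_le_one) auto
      qed (use \<eta> in auto)
      also have "\<dots> \<le> k * (\<eta> * 1) * (?\<mu> ?P + 1)" using k \<eta> by (intro mult_left_mono) auto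
      also have "\<dots> = \<eta> * K" by (simp add: K_def k_def)
      finally show ?thesis using \<eta>(3) by linarith
    qed
    \<comment> \<open>\<open>Q powr 0\<close> stands for 1, the old scale, so that
      \<open>eventually_powr_le\<close> applies. With \<open>\<delta> = 1/2\<close> these are the
      two scale conditions of \<open>measure_not_good_le\<close>.\<close>
    have e1: "\<forall>\<^sub>F Q::real in at_top. \<forall>j. Q powr (- a j) \<le> 1/4 * Q powr 0"
      using a by (intro eventually_all_finite eventually_powr_le) auto
    have e2: "\<forall>\<^sub>F Q::real in at_top. \<forall>k. Q powr 0 \<le> (2 * \<eta>) * Q powr (b k)"
      using b \<eta> by (intro eventually_all_finite eventually_powr_le) auto
    have "\<forall>\<^sub>F Q::real in at_top. (\<forall>j. Q powr (- a j) \<le> 1/4 * Q powr 0) \<and> (\<forall>k. Q powr 0 \<le> (2 * \<eta>) * Q powr (b k)) \<and> Q > 0"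
      using e1 e2 eventually_gt_at_top[of 0] by eventually_elim blast
    then have "\<forall>\<^sub>F t in sequentially. (\<forall>j. real t powr (- a j) \<le> 1/4 * real t powr 0) \<and>
        (\<forall>k. real t powr 0 \<le> (2 * \<eta>) * real t powr (b k)) \<and> real t > 0"
      by (rule eventually_compose_filterlim[OF _ filterlim_real_sequentially])
    then obtain T0 where T0: "\<And>t. t \<ge> T0 \<Longrightarrow> (\<forall>j. real t powr (- a j) \<le> 1/4 * real t powr 0) \<and>
        (\<forall>k. real t powr 0 \<le> (2 * \<eta>) * real t powr (b k)) \<and> real t > 0"
      unfolding eventually_sequentially by blast
    define covers where "covers t W \<longleftrightarrow> W \<in> lmeasurable \<and>
      {\<theta> \<in> ?P. \<not> good \<eta> (rad a (real t)) (siz b (real t)) \<theta>} \<subseteq> W \<and> ?\<mu> W \<le> e" for t W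
    have ex: "\<exists>W. covers t W"
      if t: "t \<ge> T0" for t
    proof -
      note T = T0[OF t]
      have one: "real t powr 0 = 1" using T by simp
      obtain W where W: "W \<in> lmeasurable" "{\<theta> \<in> ?P. \<not> good \<eta> (rad a (real t)) (siz b (real t)) \<theta>} \<subseteq> W"
        "?\<mu> W \<le> 3 * real CARD('n) * (54 * \<eta> / (\<sigma> * (1/2))) ^ CARD('m) * (3 * \<eta> / (1/2)) ^ CARD('n) * ?\<mu> ?P"
      proof (rule measure_not_good_le[of "\<lambda>_. 1" "\<lambda>_. 1" "rad a (real t)" "siz b (real t)" \<sigma> "1/2" \<eta> z])
        show "prod (rad a (real t)) UNIV * prod (siz b (real t)) UNIV = 1"
          using T sums by (intro vol_powr) auto
        show "\<eta> * rad a (real t) j \<le> 1/2 / 2 * 1" for j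
        proof -
          have "\<eta> * rad a (real t) j \<le> 1 * rad a (real t) j" using \<eta> by (intro mult_right_mono) auto
          also have "\<dots> \<le> 1/4" using T[THEN conjunct1, rule_format, of j] one by simp
          finally show ?thesis by simp
        qed
        show "1/2 * 1 \<le> \<eta> * siz b (real t) k" for k using T[THEN conjunct2, THEN conjunct1, rule_format, of k] one by simp
      qed (use T \<sigma> \<eta> in \<open>auto intro: good_unscaled\<close>)
      then show ?thesis unfolding covers_def using order_trans[OF W(3) size] by blast
    qed
    define W where "W t = (SOME V. covers t V)" for t
    have W: "W t \<in> lmeasurable \<and> {\<theta> \<in> ?P. \<not> good \<eta> (rad a (real t)) (siz b (real t)) \<theta>} \<subseteq> W t \<and> ?\<mu> (W t) \<le> e"
      if "t \<ge> T0" for t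
    proof -
      have "covers t (W t)" unfolding W_def by (rule someI_ex[OF ex[OF that]])
      then show ?thesis unfolding covers_def .
    qed
    \<comment> \<open>Each \<open>D T\<close> lies in a single \<open>W t\<close> and the sets
      increase with \<open>T\<close>, so finite unions, and then the countable union, have measure
      at most \<open>e\<close>.\<close>
    define D where "D T = (\<Inter>t\<in>{max T T0..}. W t)" for T
    have Dsub: "D T \<subseteq> W (max T T0)" for T by (auto simp: D_def)
    have Dm: "D T \<in> lmeasurable" for T
    proof (rule fmeasurableI2[OF _ Dsub])
      show "W (max T T0) \<in> lmeasurable" using W by simp
      show "D T \<in> sets lebesgue"
        unfolding D_def using W by (intro sets.countable_INT'') (auto intro: fmeasurableD)
    qed
    have Dle: "?\<mu> (D T) \<le> e" for T
    proof -
      have "?\<mu> (D T) \<le> ?\<mu> (W (max T T0))"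
        using W Dsub Dm by (intro measure_mono_fmeasurable) (auto intro: fmeasurableD)
      then show ?thesis using W[of "max T T0"] by simp
    qed
    have Dmono: "D T \<subseteq> D T'" if "T \<le> T'" for T T' using that by (auto simp: D_def)
    have fin: "?\<mu> (\<Union>T\<in>I. D T) \<le> e" if "finite I" for I
    proof (cases "I = {}")
      case True
      then show ?thesis using e by simp
    next
      case False
      have "(\<Union>T\<in>I. D T) \<subseteq> D (Max I)" by (intro UN_least Dmono Max_ge[OF that])
      moreover have "(\<Union>T\<in>I. D T) \<in> sets lebesgue" using that Dm by (intro sets.finite_UN) (auto intro: fmeasurableD)
      ultimately have "?\<mu> (\<Union>T\<in>I. D T) \<le> ?\<mu> (D (Max I))" using Dm by (intro measure_mono_fmeasurable)
      then show ?thesis using Dle[of "Max I"] by linarith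
    qed
    have DU: "(\<Union>T\<in>UNIV. D T) \<in> lmeasurable" "?\<mu> (\<Union>T\<in>UNIV. D T) \<le> e"
      using fmeasurable_UN_bound[of UNIV D _ e] measure_UN_bound[of UNIV D _ e] Dm fin by auto
    have "?S \<inter> ball z \<sigma> \<subseteq> (\<Union>T\<in>UNIV. D T)"
    proof
      fix \<theta> assume \<theta>: "\<theta> \<in> ?S \<inter> ball z \<sigma>"
      then have "\<theta> \<in> ?P" using ball_subset_gbox[of z \<sigma>] by auto
      moreover have "\<forall>\<^sub>F t in sequentially. \<not> good \<eta> (rad a (real t)) (siz b (real t)) \<theta>" using \<theta> \<eta> by auto
      then obtain T where "\<And>t. t \<ge> T \<Longrightarrow> \<not> good \<eta> (rad a (real t)) (siz b (real t)) \<theta>"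
        unfolding eventually_sequentially by blast
      ultimately have "\<theta> \<in> W t" if "t \<ge> max T T0" for t using W[of t] that by auto
      then have "\<theta> \<in> D T" by (auto simp: D_def)
      then show "\<theta> \<in> (\<Union>T\<in>UNIV. D T)" by blast
    qed
    then show "\<exists>T. ?S \<inter> ball z \<sigma> \<subseteq> T \<and> T \<in> lmeasurable \<and> ?\<mu> T \<le> e" using DU by blast
  qed
  then show ?thesis
    unfolding locally_negligible_alt[of ?S]
    by (metis (no_types, lifting) IntI centre_in_ball openin_open_Int open_ball \<sigma>(1))
qed

section \<open>The exceptional set seen from the cubes of level 0\<close>

text \<open>A bad matrix is either never frequently good at level 0, a null event, or it belongs to
  one of countably many sets \<open>S T h\<close>. Around each point of such a set, arbitrarily
  small cubes contain a fixed proportion of simultaneous hits, which lie outside the set, so its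
  upper density is less than one.\<close>

lemma negligible_not_simultaneous_hits:
  fixes a :: "nat \<Rightarrow> 'm::finite \<Rightarrow> real" and b :: "nat \<Rightarrow> 'n::finite \<Rightarrow> real"
  assumes N: "N \<ge> 1" and e: "e > 0"
    and sums: "\<And>i. i \<le> L \<Longrightarrow> (\<Sum>j\<in>UNIV. a i j) = (\<Sum>k\<in>UNIV. b i k)"
    and inca: "\<And>i j. i < L \<Longrightarrow> a i j < a (Suc i) j" and incb: "\<And>i k. i < L \<Longrightarrow> b i k < b (Suc i) k"
    and a0: "\<And>j. a 0 j = A" "A > 0" and b0: "\<And>k. b 0 k = B" "B > 0"
  shows "negligible {\<theta>::real^'n^'m. \<not> (\<forall>T. \<exists>t\<ge>T. \<forall>l\<in>{0<..L}.
     \<theta> \<in> hits N (vp l) (vq l) e (rad (a l) (real t)) (siz (b l) (real t)))}" (is "negligible ?Bad")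
proof -
  let ?\<mu> = "measure lebesgue"
  define H :: "nat \<Rightarrow> (real^'n^'m) set" where
    "H t = {\<theta>. \<forall>l\<in>{0<..L}. \<theta> \<in> hits N (vp l) (vq l) e (rad (a l) (real t)) (siz (b l) (real t))}" for t
  \<comment> \<open>Fixing the last time \<open>T\<close> of a hit and a goodness constant
    \<open>1 / Suc h\<close> makes the proportion uniform on each piece, while the pieces remain
    countable in number.\<close>
  define S where "S T h = {\<theta>. (\<forall>t\<ge>T. \<theta> \<notin> H t) \<and>
    (\<exists>\<^sub>F t in sequentially. good (1 / real (Suc h)) (rad (a 0) (real t)) (siz (b 0) (real t)) \<theta>)}" for T h
  define Z where "Z = {\<theta>::real^'n^'m. \<forall>\<eta>>0. \<forall>\<^sub>F t in sequentially. \<not> good \<eta> (rad (a 0) (real t)) (siz (b 0) (real t)) \<theta>}"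
  have Zneg: "negligible Z"
    unfolding Z_def using a0 b0 sums[of 0] by (intro negligible_never_good) auto
  have Sneg: "negligible (S T h)" for T h
  proof -
    define \<sigma> where "\<sigma> = 1 / (2 * real CARD('n))"
    have \<sigma>: "\<sigma> > 0" "real CARD('n) * \<sigma> \<le> 1/2" by (auto simp: \<sigma>_def)
    define reach where "reach c Q \<longleftrightarrow> (\<forall>\<theta>0::real^'n^'m. good (1 / real (Suc h)) (rad (a 0) Q) (siz (b 0) Q) \<theta>0 \<longrightarrow>
     (\<exists>U\<in>lmeasurable. U \<subseteq> mbox \<theta>0 \<sigma> (rad (a 0) Q) (siz (b 0) Q) \<and>
        (\<forall>l\<in>{0<..L}. U \<subseteq> hits N (vp l) (vq l) e (rad (a l) Q) (siz (b l) Q)) \<and>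
        c * ?\<mu> (mbox \<theta>0 \<sigma> (rad (a 0) Q) (siz (b 0) Q)) \<le> ?\<mu> U))" for c Q
    have "\<exists>c>0. \<forall>\<^sub>F Q in at_top. reach c Q"
      unfolding reach_def
      by (rule positive_proportion_hits[where a = a and b = b and L = L, OF N e sums inca incb le0 \<sigma>]) simp_all
    then obtain c where c: "c > 0" and ev: "\<forall>\<^sub>F Q in at_top. reach c Q" by blast
    \<comment> \<open>A cube of half side \<open>s\<close> lies in the ball of radius
      \<open>mn * s\<close>, which lies in the cube of half side \<open>mn * s\<close>;
      \<open>K\<close> is the volume ratio of the two cubes.\<close>
    define mn where "mn = 2 * real CARD('m) * real CARD('n)"
    have mn: "mn > 0" by (simp add: mn_def)
    define K where "K = (mn ^ CARD('n)) ^ CARD('m)"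
    have K: "K > 0" using mn by (simp add: K_def)
    show ?thesis
    proof (rule negligible_upper_density_lt_1[of "min 1 (c / K)"])
      show "0 < min 1 (c / K)" "min 1 (c / K) \<le> 1" using c K by auto
      fix x \<epsilon> assume x: "x \<in> S T h" and \<epsilon>: "\<epsilon> > (0::real)"
      have e1: "\<forall>\<^sub>F Q::real in at_top. Q powr (- A) \<le> (\<epsilon> / (2 * mn * \<sigma>)) * Q powr B"
        using a0(2) b0(2) \<epsilon> mn \<sigma> by (intro eventually_powr_le) auto
      \<comment> \<open>The second condition makes the enclosing ball smaller than
        \<open>\<epsilon>\<close>; the last one puts the hits at a time that \<open>S T h\<close>
        excludes.\<close>
      define good_time where "good_time Q \<longleftrightarrow> reach c Q
        \<and> Q powr (- A) \<le> (\<epsilon> / (2 * mn * \<sigma>)) * Q powr B \<and> Q > 0 \<and> Q \<ge> real T" for Q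
      have "\<forall>\<^sub>F Q in at_top. good_time Q"
        unfolding good_time_def using ev e1 eventually_gt_at_top[of 0] eventually_ge_at_top[of "real T"]
        by (intro eventually_conj)
      then have "\<forall>\<^sub>F t in sequentially. good_time (real t)"
        by (rule eventually_compose_filterlim[OF _ filterlim_real_sequentially])
      moreover have "\<exists>\<^sub>F t in sequentially. good (1 / real (Suc h)) (rad (a 0) (real t)) (siz (b 0) (real t)) x"
        using x by (simp add: S_def)
      ultimately obtain t where g: "good (1 / real (Suc h)) (rad (a 0) (real t)) (siz (b 0) (real t)) x" and gt: "good_time (real t)"
        using frequently_ex[OF frequently_eventually_frequently] by blast
      have t: "real t powr (- A) \<le> (\<epsilon> / (2 * mn * \<sigma>)) * real t powr B" "real t > 0" "t \<ge> T"
        using gt by (auto simp: good_time_def)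
      obtain U where U: "U \<in> lmeasurable" "U \<subseteq> mbox x \<sigma> (rad (a 0) (real t)) (siz (b 0) (real t))"
        "\<And>l. l \<in> {0<..L} \<Longrightarrow> U \<subseteq> hits N (vp l) (vq l) e (rad (a l) (real t)) (siz (b l) (real t))"
        "c * ?\<mu> (mbox x \<sigma> (rad (a 0) (real t)) (siz (b 0) (real t))) \<le> ?\<mu> U"
        using gt[unfolded good_time_def reach_def, THEN conjunct1, THEN spec[of _ x], THEN mp[OF _ g]] by blast
      define s where "s = \<sigma> * real t powr (- A) / real t powr B"
      have s: "s > 0" using \<sigma> t by (simp add: s_def)
      have mb: "mbox x \<sigma> (rad (a 0) (real t)) (siz (b 0) (real t)) = gbox x (\<lambda>_ _. s)"
        by (simp add: s_def a0 b0)
      have UH: "U \<subseteq> H t" using U(3) unfolding H_def by blast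
      have "mn * s \<le> \<epsilon> / 2"
      proof -
        have "real t powr (- A) / real t powr B \<le> \<epsilon> / (2 * mn * \<sigma>)"
          using t by (simp add: pos_divide_le_eq)
        then have "mn * \<sigma> * (real t powr (- A) / real t powr B) \<le> mn * \<sigma> * (\<epsilon> / (2 * mn * \<sigma>))"
          using mn \<sigma> by (intro mult_left_mono) auto
        then show ?thesis using mn \<sigma> by (simp add: s_def mult.assoc)
      qed
      then have d: "mn * s < \<epsilon>" using \<epsilon> by simp
      have box_measure: "?\<mu> (gbox x (\<lambda>_ _. w)) = ((2 * w) ^ CARD('n)) ^ CARD('m)" if "w \<ge> 0" for w
        using that by (subst measure_gbox) simp_all
      have "?\<mu> (ball x (mn * s)) \<le> ?\<mu> (gbox x (\<lambda>_ _. mn * s))"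
        by (intro measure_mono_fmeasurable ball_subset_gbox) auto
      also have "\<dots> = ((2 * (mn * s)) ^ CARD('n)) ^ CARD('m)" using s mn by (intro box_measure) auto
      also have "2 * (mn * s) = mn * (2 * s)" by simp
      also have "((mn * (2 * s)) ^ CARD('n)) ^ CARD('m) = K * ((2 * s) ^ CARD('n)) ^ CARD('m)"
        unfolding K_def by (simp only: power_mult_distrib)
      also have "((2 * s) ^ CARD('n)) ^ CARD('m) = ?\<mu> (gbox x (\<lambda>_ _. s))"
        using s by (intro box_measure[symmetric]) auto
      finally have ballK: "?\<mu> (ball x (mn * s)) \<le> K * ?\<mu> (gbox x (\<lambda>_ _. s))" .
      have "min 1 (c / K) * ?\<mu> (ball x (mn * s)) \<le> c / K * (K * ?\<mu> (gbox x (\<lambda>_ _. s)))"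
        using ballK c K by (intro mult_mono) auto
      also have "\<dots> = c * ?\<mu> (gbox x (\<lambda>_ _. s))" using K by simp
      also have "\<dots> \<le> ?\<mu> U" using U(4) unfolding mb .
      finally have m: "min 1 (c / K) * ?\<mu> (ball x (mn * s)) \<le> ?\<mu> U" .
      have Ub: "U \<subseteq> ball x (mn * s)" using U(2) gbox_subset_ball[OF s, of x] unfolding mb mn_def by blast
      have dis: "S T h \<inter> U = {}" using UH t(3) unfolding S_def by blast
      show "\<exists>d U. 0 < d \<and> d < \<epsilon> \<and> U \<in> lmeasurable \<and> U \<subseteq> ball x d \<and> S T h \<inter> U = {} \<and>
           min 1 (c / K) * ?\<mu> (ball x d) \<le> ?\<mu> U"
        using mn s d U(1) Ub dis m by (intro exI[of _ "mn * s"] exI[of _ U] conjI) auto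
    qed
  qed
  have "?Bad \<subseteq> Z \<union> (\<Union>x\<in>UNIV. S (fst x) (snd x))"
  proof
    fix \<theta> assume "\<theta> \<in> ?Bad"
    then obtain T where T: "\<forall>t\<ge>T. \<theta> \<notin> H t" by (auto simp: H_def)
    show "\<theta> \<in> Z \<union> (\<Union>x\<in>UNIV. S (fst x) (snd x))"
    proof (cases "\<theta> \<in> Z")
      case False
      then obtain \<eta> where \<eta>: "\<eta> > 0" and fr: "\<exists>\<^sub>F t in sequentially. good \<eta> (rad (a 0) (real t)) (siz (b 0) (real t)) \<theta>"
        by (auto simp: Z_def frequently_def)
      obtain h where h: "1 / real (Suc h) < \<eta>" using \<eta> nat_approx_posE by blast
      have "good (1 / real (Suc h)) (rad (a 0) (real t)) (siz (b 0) (real t)) \<theta>"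
        if g: "good \<eta> (rad (a 0) (real t)) (siz (b 0) (real t)) \<theta>" for t
        unfolding good_def
      proof (intro allI impI)
        fix p q assume p: "\<forall>j. \<bar>lf \<theta> p q j\<bar> \<le> 1 / real (Suc h) * rad (a 0) (real t) j"
          and q: "\<forall>k. \<bar>real_of_int (q k)\<bar> \<le> 1 / real (Suc h) * siz (b 0) (real t) k"
        have m: "1 / real (Suc h) * y \<le> \<eta> * y" if "y \<ge> 0" for y using h that by (intro mult_right_mono) auto
        have "\<bar>lf \<theta> p q j\<bar> \<le> \<eta> * rad (a 0) (real t) j" for j
          using p[rule_format, of j] m[of "rad (a 0) (real t) j"] by simp
        moreover have "\<bar>real_of_int (q k)\<bar> \<le> \<eta> * siz (b 0) (real t) k" for k
          using q[rule_format, of k] m[of "siz (b 0) (real t) k"] by simp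
        ultimately show "p = (\<lambda>_. 0) \<and> q = (\<lambda>_. 0)" using g unfolding good_def by blast
      qed
      then have "\<exists>\<^sub>F t in sequentially. good (1 / real (Suc h)) (rad (a 0) (real t)) (siz (b 0) (real t)) \<theta>"
        by (rule frequently_elim1[OF fr])
      then have "\<theta> \<in> S T h" using T by (simp add: S_def)
      then show ?thesis by (intro UnI2 UN_I[of "(T,h)"]) auto
    qed simp
  qed
  moreover have "negligible (Z \<union> (\<Union>x\<in>UNIV. S (fst x) (snd x)))"
    using Zneg Sneg by (intro negligible_Un negligible_countable_Union) auto
  ultimately show ?thesis by (rule negligible_subset[rotated])
qed

section \<open>Return to quasi-norms, individual moduli and the given weights\<close>

lemma qnorm_le:
  assumes "\<And>j. a j > 0" "B > 0" "\<And>j. \<bar>x $ j\<bar> \<le> B powr (a j)"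
  shows "qnorm a x \<le> B"
  unfolding qnorm_def
proof (rule Max.boundedI)
  fix y assume "y \<in> range (\<lambda>j. \<bar>x $ j\<bar> powr (1 / a j))"
  then obtain j where y: "y = \<bar>x $ j\<bar> powr (1 / a j)" by blast
  have "y \<le> (B powr (a j)) powr (1 / a j)"
    unfolding y using assms(1)[of j] assms(3)[of j] by (intro powr_mono2) auto
  also have "\<dots> = B" using assms(1)[of j] assms(2) by (simp add: powr_powr)
  finally show "y \<le> B" .
qed auto

theorem theorem1p4:
  fixes \<epsilon> :: real and L :: nat
    and Np :: "nat \<Rightarrow> 'm::finite \<Rightarrow> nat" and Nq :: "nat \<Rightarrow> 'n::finite \<Rightarrow> nat"
    and vp :: "nat \<Rightarrow> 'm \<Rightarrow> int" and vq :: "nat \<Rightarrow> 'n \<Rightarrow> int"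
    and \<alpha> :: "nat \<Rightarrow> 'm \<Rightarrow> real" and \<beta> :: "nat \<Rightarrow> 'n \<Rightarrow> real"
    and \<kappa> :: "nat \<Rightarrow> real"
  assumes eps: "\<epsilon> > 0"
    and N_pos: "\<forall>i\<in>{1..L}. (\<forall>j. Np i j \<ge> 1) \<and> (\<forall>j. Nq i j \<ge> 1)"
    and weights: "\<forall>i\<in>{1..L}. is_weight (\<alpha> i) \<and> is_weight (\<beta> i)"
    and kappa_pos: "\<forall>i\<in>{1..L}. \<kappa> i > 0"
    and incr: "\<forall>i\<in>{2..L}. (\<forall>j. \<kappa> i * \<alpha> i j - \<kappa> (i - 1) * \<alpha> (i - 1) j > 0)
                              \<and> (\<forall>j. \<kappa> i * \<beta> i j - \<kappa> (i - 1) * \<beta> (i - 1) j > 0)"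
  shows "AE (\<theta> :: real^'n^'m) in lborel.
           \<forall>Q0. \<exists>Q::real. Q \<ge> Q0 \<and>
             (\<forall>i\<in>{1..L}. \<exists>(p :: int^'m) (q :: int^'n).
                qnorm (\<alpha> i) (\<theta> *v int_to_real_vec q + int_to_real_vec p) \<le> \<epsilon> * Q powr (- \<kappa> i)
              \<and> qnorm (\<beta> i) (int_to_real_vec q) \<le> \<epsilon> * Q powr (\<kappa> i)
              \<and> (\<forall>j. [p $ j = vp i j] (mod int (Np i j)))
              \<and> (\<forall>j. [q $ j = vq i j] (mod int (Nq i j))))"
proof -
  \<comment> \<open>All weights lie between 0 and 1, so \<open>min 1 \<epsilon>\<close> is at most
    \<open>\<epsilon> powr w\<close> for every entry \<open>w\<close>; this is \<open>ep\<close>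
    below.\<close>
  define e where "e = min 1 \<epsilon>"
  have e: "e > 0" using eps by (simp add: e_def)
  \<comment> \<open>A congruence modulo the product of all moduli implies each individual
    one.\<close>
  define N where "N = (\<Prod>i\<in>{1..L}. (\<Prod>j\<in>UNIV. int (Np i j)) * (\<Prod>k\<in>UNIV. int (Nq i k)))"
  have Np0: "int (Np i j) \<ge> 1" and Nq0: "int (Nq i k) \<ge> 1" if "i \<in> {1..L}" for i j k
    using N_pos that by (auto simp: Suc_le_eq)
  have N: "N \<ge> 1"
  proof -
    have "N > 0" unfolding N_def using Np0 Nq0 by (intro prod_pos mult_pos_pos) (auto simp: int_one_le_iff_zero_less)
    then show ?thesis by simp
  qed
  have dvd: "int (Np i j) dvd N" "int (Nq i k) dvd N" if i: "i \<in> {1..L}" for i j k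
  proof -
    have "(\<Prod>j\<in>UNIV. int (Np i j)) * (\<Prod>k\<in>UNIV. int (Nq i k)) dvd N"
      unfolding N_def using i by (intro dvd_prodI) auto
    moreover have "int (Np i j) dvd (\<Prod>j\<in>UNIV. int (Np i j))" "int (Nq i k) dvd (\<Prod>k\<in>UNIV. int (Nq i k))"
      by (intro dvd_prodI; simp)+
    ultimately show "int (Np i j) dvd N" "int (Nq i k) dvd N" by (meson dvd_mult_left dvd_mult_right dvd_trans)+
  qed
  have wa: "\<alpha> i j > 0" "(\<Sum>j\<in>UNIV. \<alpha> i j) = 1" "\<beta> i k > 0" "(\<Sum>k\<in>UNIV. \<beta> i k) = 1" if "i \<in> {1..L}" for i j k
    using weights that by (auto simp: is_weight_def)
  have le1: "\<alpha> i j \<le> 1" "\<beta> i k \<le> 1" if i: "i \<in> {1..L}" for i j k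
  proof -
    have "\<alpha> i j \<le> (\<Sum>j\<in>UNIV. \<alpha> i j)" using wa[OF i] by (intro member_le_sum) (auto simp: less_imp_le)
    then show "\<alpha> i j \<le> 1" using wa[OF i] by simp
    have "\<beta> i k \<le> (\<Sum>k\<in>UNIV. \<beta> i k)" using wa[OF i] by (intro member_le_sum) (auto simp: less_imp_le)
    then show "\<beta> i k \<le> 1" using wa[OF i] by simp
  qed
  \<comment> \<open>The total exponent of level 0, shared equally among the rows and among the
    columns and small enough to stay below level 1. For \<open>L = 0\<close> there is no level 1 to
    compare with and any positive value works.\<close>
  obtain A where A: "A > 0" "\<And>j. L \<ge> 1 \<Longrightarrow> A / real CARD('m) < \<kappa> 1 * \<alpha> 1 j"
    "\<And>k. L \<ge> 1 \<Longrightarrow> A / real CARD('n) < \<kappa> 1 * \<beta> 1 k"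
  proof (cases "L \<ge> 1")
    case False
    then show ?thesis using that[of 1] by auto
  next
    case True
    then have 1: "1 \<in> {1..L}" by simp
    have pos: "\<kappa> 1 * \<alpha> 1 j > 0" "\<kappa> 1 * \<beta> 1 k > 0" for j k using wa[OF 1] kappa_pos 1 by auto
    define M where "M = min (Min (range (\<lambda>j. \<kappa> 1 * \<alpha> 1 j))) (Min (range (\<lambda>k. \<kappa> 1 * \<beta> 1 k)))"
    have M: "M > 0" unfolding M_def using pos by (auto simp: Min_gr_iff)
    have "Min (range (\<lambda>j. \<kappa> 1 * \<alpha> 1 j)) \<le> \<kappa> 1 * \<alpha> 1 j" "Min (range (\<lambda>k. \<kappa> 1 * \<beta> 1 k)) \<le> \<kappa> 1 * \<beta> 1 k" for j k
      by (rule Min_le; blast intro: finite_imageI[OF finite])+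
    then have Mle: "M \<le> \<kappa> 1 * \<alpha> 1 j" "M \<le> \<kappa> 1 * \<beta> 1 k" for j k
      unfolding M_def by (meson min.coboundedI1 min.coboundedI2)+
    have "M / 2 / real (Suc n) < M" for n
    proof -
      have "M / 2 / real (Suc n) \<le> M / 2" using M by (simp add: pos_divide_le_eq)
      then show ?thesis using M by linarith
    qed
    from this[of "CARD('m) - 1"] this[of "CARD('n) - 1"] have "M / 2 / real CARD('m) < M" "M / 2 / real CARD('n) < M"
      by simp_all
    then show ?thesis using that[of "M / 2"] M Mle by (meson half_gt_zero less_le_trans)
  qed
  define a where "a i = (if i = 0 then (\<lambda>j. A / real CARD('m)) else (\<lambda>j. \<kappa> i * \<alpha> i j))" for i
  define b where "b i = (if i = 0 then (\<lambda>k. A / real CARD('n)) else (\<lambda>k. \<kappa> i * \<beta> i k))" for i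
  have neg: "negligible {\<theta>::real^'n^'m. \<not> (\<forall>T. \<exists>t\<ge>T. \<forall>l\<in>{0<..L}.
     \<theta> \<in> hits N (vp l) (vq l) e (rad (a l) (real t)) (siz (b l) (real t)))}" (is "negligible ?Bad")
  proof (rule negligible_not_simultaneous_hits[OF N e, of L a b "A / real CARD('m)" "A / real CARD('n)"])
    show "sum (a i) UNIV = sum (b i) UNIV" if "i \<le> L" for i
    proof (cases "i = 0")
      case False
      then have "i \<in> {1..L}" using that by simp
      from wa(2,4)[OF this] False show ?thesis by (simp add: a_def b_def flip: sum_distrib_left)
    qed (simp add: a_def b_def)
    show "a i j < a (Suc i) j" if "i < L" for i j
    proof (cases "i = 0")
      case True
      then show ?thesis using A(2)[of j] that by (simp add: a_def)
    next
      case False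
      then have "Suc i \<in> {2..L}" using that by simp
      from incr[rule_format, OF this] False show ?thesis by (simp add: a_def)
    qed
    show "b i k < b (Suc i) k" if "i < L" for i k
    proof (cases "i = 0")
      case True
      then show ?thesis using A(3)[of k] that by (simp add: b_def)
    next
      case False
      then have "Suc i \<in> {2..L}" using that by simp
      from incr[rule_format, OF this] False show ?thesis by (simp add: b_def)
    qed
  qed (use A in \<open>auto simp: a_def b_def\<close>)
  have key: "\<exists>(p :: int^'m) (q :: int^'n).
                qnorm (\<alpha> i) (\<theta> *v int_to_real_vec q + int_to_real_vec p) \<le> \<epsilon> * Q powr (- \<kappa> i)
              \<and> qnorm (\<beta> i) (int_to_real_vec q) \<le> \<epsilon> * Q powr (\<kappa> i)
              \<and> (\<forall>j. [p $ j = vp i j] (mod int (Np i j)))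
              \<and> (\<forall>j. [q $ j = vq i j] (mod int (Nq i j)))"
    if i: "i \<in> {1..L}" and Q: "Q > 0" and h: "\<theta> \<in> hits N (vp i) (vq i) e (rad (a i) Q) (siz (b i) Q)"
    for i Q and \<theta> :: "real^'n^'m"
  proof -
    from h obtain p q where p: "\<And>j. [p j = vp i j] (mod N)" and q: "\<And>k. [q k = vq i k] (mod N)"
      and lp: "\<And>j. \<bar>lf \<theta> p q j\<bar> \<le> e * rad (a i) Q j" and lq: "\<And>k. \<bar>real_of_int (q k)\<bar> \<le> e * siz (b i) Q k"
      unfolding hits_def by blast
    have ai: "a i = (\<lambda>j. \<kappa> i * \<alpha> i j)" "b i = (\<lambda>k. \<kappa> i * \<beta> i k)" using i by (auto simp: a_def b_def)
    have ep: "e \<le> \<epsilon> powr w" if "0 < w" "w \<le> 1" for w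
    proof (cases "\<epsilon> \<le> 1")
      case True
      then have "\<epsilon> powr 1 \<le> \<epsilon> powr w" using that eps by (intro powr_mono') auto
      then show ?thesis using eps True by (simp add: e_def)
    next
      case False
      then have "1 \<le> \<epsilon> powr w" using that by (intro ge_one_powr_ge_zero) auto
      then show ?thesis using False by (simp add: e_def)
    qed
    have split: "(\<epsilon> * Q powr y) powr w = \<epsilon> powr w * Q powr (y * w)" for y w
      using eps Q by (simp add: powr_mult powr_powr)
    have comp: "(\<theta> *v int_to_real_vec (\<chi> k. q k) + int_to_real_vec (\<chi> j. p j)) $ j = lf \<theta> p q j" for j
      by (simp add: lf_def matrix_vector_mult_def int_to_real_vec_def)
    have "qnorm (\<alpha> i) (\<theta> *v int_to_real_vec (\<chi> k. q k) + int_to_real_vec (\<chi> j. p j)) \<le> \<epsilon> * Q powr (- \<kappa> i)"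
    proof (rule qnorm_le)
      fix j
      have "e * rad (a i) Q j \<le> \<epsilon> powr \<alpha> i j * rad (a i) Q j"
        using ep wa[OF i] le1[OF i] by (intro mult_right_mono) auto
      then show "\<bar>(\<theta> *v int_to_real_vec (\<chi> k. q k) + int_to_real_vec (\<chi> j. p j)) $ j\<bar> \<le> (\<epsilon> * Q powr (- \<kappa> i)) powr \<alpha> i j"
        unfolding comp split using lp[of j] by (simp add: ai)
    qed (use wa[OF i] eps Q in auto)
    moreover have "qnorm (\<beta> i) (int_to_real_vec (\<chi> k. q k)) \<le> \<epsilon> * Q powr (\<kappa> i)"
    proof (rule qnorm_le)
      fix k
      have "e * siz (b i) Q k \<le> \<epsilon> powr \<beta> i k * siz (b i) Q k"
        using ep wa[OF i] le1[OF i] by (intro mult_right_mono) auto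
      then show "\<bar>int_to_real_vec (\<chi> k. q k) $ k\<bar> \<le> (\<epsilon> * Q powr (\<kappa> i)) powr \<beta> i k"
        unfolding split using lq[of k] by (simp add: ai int_to_real_vec_def)
    qed (use wa[OF i] eps Q in auto)
    moreover have "[p j = vp i j] (mod int (Np i j))" for j using p dvd(1)[OF i] by (rule cong_dvd_modulus)
    moreover have "[q k = vq i k] (mod int (Nq i k))" for k using q dvd(2)[OF i] by (rule cong_dvd_modulus)
    ultimately show ?thesis by (intro exI[of _ "\<chi> j. p j"] exI[of _ "\<chi> k. q k"]) simp
  qed
  have "?Bad \<in> null_sets lebesgue" using neg by (simp add: negligible_iff_null_sets)
  then have "AE \<theta> in lebesgue. \<theta> \<notin> ?Bad" by (rule AE_not_in)
  then have "AE \<theta> in lborel. \<theta> \<notin> ?Bad" by (simp only: AE_completion_iff)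
  then show ?thesis
  proof (rule AE_mp, intro AE_I2 impI allI)
    fix \<theta> :: "real^'n^'m" and Q0 :: real
    assume "\<theta> \<notin> ?Bad"
    then have all: "\<And>T. \<exists>t\<ge>T. \<forall>l\<in>{0<..L}. \<theta> \<in> hits N (vp l) (vq l) e (rad (a l) (real t)) (siz (b l) (real t))" by blast
    \<comment> \<open>Starting from 1 ensures \<open>real t > 0\<close>, which the rules for
      \<open>powr\<close> in \<open>key\<close> require.\<close>
    obtain t where t: "t \<ge> max 1 (nat \<lceil>Q0\<rceil>)" "\<And>l. l \<in> {0<..L} \<Longrightarrow> \<theta> \<in> hits N (vp l) (vq l) e (rad (a l) (real t)) (siz (b l) (real t))"
      using all[of "max 1 (nat \<lceil>Q0\<rceil>)"] by blast
    have tQ: "real t \<ge> Q0" "real t > 0" using t(1) by linarith+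
    have "{0<..L} = {1..L}" by auto
    then show "\<exists>Q::real. Q \<ge> Q0 \<and>
             (\<forall>i\<in>{1..L}. \<exists>(p :: int^'m) (q :: int^'n).
                qnorm (\<alpha> i) (\<theta> *v int_to_real_vec q + int_to_real_vec p) \<le> \<epsilon> * Q powr (- \<kappa> i)
              \<and> qnorm (\<beta> i) (int_to_real_vec q) \<le> \<epsilon> * Q powr (\<kappa> i)
              \<and> (\<forall>j. [p $ j = vp i j] (mod int (Np i j)))
              \<and> (\<forall>j. [q $ j = vq i j] (mod int (Nq i j))))"
      using tQ key t(2) by (intro exI[of _ "real t"]) auto
  qed
qed

end
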